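(* Let $G=\{g_1,\dots,g_n\}$ be a non-trivial finite group of order $n$ and let $\mathbb Z=\langle t\rangle$. The (Kesten) spectral measure for the random walk on $G\,\mathrm{wr}\,\mathbb Z$ with respect to the symmetric generating set $$S=\{tg_1,\dots,tg_n,\ g_1t^{-1},\dots,g_nt^{-1}\}$$ is $$\mu=(n-1)^2\sum_{q=2}^{\infty}\ \sum_{1\le p<q,\ (p,q)=1}\frac{1}{n^q-1}\,\delta_{\cos\frac pq\pi}.$$
   Context: $G\,\mathrm{wr}\,\mathbb Z=\left(\bigoplus_{\mathbb Z}G\right)\rtimes\mathbb Z$ is the restricted wreath product, with $\mathbb Z=\langle t\rangle$ acting by the shift, and $G$ is identified with the copy of $G$ at coordinate $0$ in $\bigoplus_{\mathbb Z}G$. For a group $\Lambda$ with finite symmetric generating set $S$, the Markov operator of the simple random walk on the Cayley graph is $Mf(g)=\frac1{|S|}\sum_{s\in S}f(sg)$ on $\ell^2(\Lambda)$; it is self-adjoint with projection-valued spectral measure $E$, and the (Kesten) spectral measure of the random walk is the probability measure $B\mapsto\langle E(B)\delta_1,\delta_1\rangle$ on Borel subsets of $[-1,1]$, where $\delta_1$ is the characteristic function of the identity. $\delta_{x}$ for $x\in\mathbb R$ denotes the Dirac measure at $x$, and $(p,q)$ the greatest common divisor. *)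

theory Defs
  imports "HOL-Probability.Probability" "HOL-Algebra.Product_Groups"
begin

section \<open>Restricted wreath products with the integers\<close>

definition semidirect_product ::
    "('a, 'c) monoid_scheme \<Rightarrow> ('b, 'd) monoid_scheme \<Rightarrow> ('b \<Rightarrow> 'a \<Rightarrow> 'a) \<Rightarrow> ('a \<times> 'b) monoid"
  where "semidirect_product N H \<phi> =
    \<lparr>carrier = carrier N \<times> carrier H,
     monoid.mult = (\<lambda>(x, h) (y, k). (x \<otimes>\<^bsub>N\<^esub> \<phi> h y, h \<otimes>\<^bsub>H\<^esub> k)),
     one = (\<one>\<^bsub>N\<^esub>, \<one>\<^bsub>H\<^esub>)\<rparr>"

text \<open>The generator of the integers moves coordinate \<open>i\<close> to coordinate \<open>i + 1\<close>.\<close>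

definition shift :: "int \<Rightarrow> (int \<Rightarrow> 'a) \<Rightarrow> (int \<Rightarrow> 'a)"
  where "shift k f = (\<lambda>i. f (i - k))"

definition wreath_int :: "('a, 'b) monoid_scheme \<Rightarrow> ((int \<Rightarrow> 'a) \<times> int) monoid"
  where "wreath_int G = semidirect_product (sum_group UNIV (\<lambda>_. G)) integer_group shift"

definition wreath_embed :: "('a, 'b) monoid_scheme \<Rightarrow> 'a \<Rightarrow> (int \<Rightarrow> 'a) \<times> int"
  where "wreath_embed G g = ((\<lambda>i. if i = 0 then g else \<one>\<^bsub>G\<^esub>), 0)"

definition wreath_t :: "('a, 'b) monoid_scheme \<Rightarrow> (int \<Rightarrow> 'a) \<times> int"
  where "wreath_t G = ((\<lambda>_. \<one>\<^bsub>G\<^esub>), 1)"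

definition wreath_gens :: "('a, 'b) monoid_scheme \<Rightarrow> ((int \<Rightarrow> 'a) \<times> int) set"
  where "wreath_gens G =
    {wreath_t G \<otimes>\<^bsub>wreath_int G\<^esub> wreath_embed G g | g. g \<in> carrier G} \<union>
    {wreath_embed G g \<otimes>\<^bsub>wreath_int G\<^esub> inv\<^bsub>wreath_int G\<^esub> wreath_t G | g. g \<in> carrier G}"

section \<open>Square-summable functions and projection-valued measures\<close>

text \<open>Elements of \<open>\<ell>\<^sup>2(A)\<close> are complex functions on the whole type that vanish off \<open>A\<close>.\<close>

definition l2 :: "'a set \<Rightarrow> ('a \<Rightarrow> complex) set"
  where "l2 A = {f. (\<forall>x. x \<notin> A \<longrightarrow> f x = 0) \<and> (\<lambda>x. (cmod (f x))\<^sup>2) summable_on A}"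

definition l2_inner :: "'a set \<Rightarrow> ('a \<Rightarrow> complex) \<Rightarrow> ('a \<Rightarrow> complex) \<Rightarrow> complex"
  where "l2_inner A f h = (\<Sum>\<^sub>\<infinity>x\<in>A. f x * cnj (h x))"

definition l2_norm :: "'a set \<Rightarrow> ('a \<Rightarrow> complex) \<Rightarrow> real"
  where "l2_norm A f = sqrt (\<Sum>\<^sub>\<infinity>x\<in>A. (cmod (f x))\<^sup>2)"

definition orthogonal_projection :: "'a set \<Rightarrow> (('a \<Rightarrow> complex) \<Rightarrow> ('a \<Rightarrow> complex)) \<Rightarrow> bool"
  where "orthogonal_projection A P \<longleftrightarrow>
    (\<forall>f\<in>l2 A. P f \<in> l2 A) \<and>
    (\<forall>f\<in>l2 A. \<forall>h\<in>l2 A. P (\<lambda>x. f x + h x) = (\<lambda>x. P f x + P h x)) \<and>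
    (\<forall>f\<in>l2 A. \<forall>c. P (\<lambda>x. c * f x) = (\<lambda>x. c * P f x)) \<and>
    (\<forall>f\<in>l2 A. P (P f) = P f) \<and>
    (\<forall>f\<in>l2 A. \<forall>h\<in>l2 A. l2_inner A (P f) h = l2_inner A f (P h))"

text \<open>Countable additivity is with respect to the strong operator topology.\<close>

definition projection_valued_measure ::
    "'a set \<Rightarrow> 'x measure \<Rightarrow> ('x set \<Rightarrow> ('a \<Rightarrow> complex) \<Rightarrow> ('a \<Rightarrow> complex)) \<Rightarrow> bool"
  where "projection_valued_measure A X E \<longleftrightarrow>
    (\<forall>B\<in>sets X. orthogonal_projection A (E B)) \<and>
    (\<forall>f\<in>l2 A. E {} f = (\<lambda>_. 0)) \<and>
    (\<forall>f\<in>l2 A. E (space X) f = f) \<and>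
    (\<forall>B\<in>sets X. \<forall>C\<in>sets X. \<forall>f\<in>l2 A. E (B \<inter> C) f = E B (E C f)) \<and>
    (\<forall>F::nat \<Rightarrow> 'x set. range F \<subseteq> sets X \<longrightarrow> disjoint_family F \<longrightarrow>
      (\<forall>f\<in>l2 A. (\<lambda>N. l2_norm A (\<lambda>x. E (\<Union>i. F i) f x - (\<Sum>i<N. E (F i) f x))) \<longlonglongrightarrow> 0))"

text \<open>The scalar measure \<open>B \<mapsto> \<langle>E(B)f, f\<rangle>\<close>; these numbers are real and nonnegative.\<close>

definition scalar_measure ::
    "'a set \<Rightarrow> 'x measure \<Rightarrow> ('x set \<Rightarrow> ('a \<Rightarrow> complex) \<Rightarrow> ('a \<Rightarrow> complex)) \<Rightarrow> ('a \<Rightarrow> complex) \<Rightarrow> 'x measure"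
  where "scalar_measure A X E f =
    measure_of (space X) (sets X) (\<lambda>B. ennreal (Re (l2_inner A (E B f) f)))"

abbreviation borel_unit :: "real measure"
  where "borel_unit \<equiv> restrict_space borel {-1..1}"

text \<open>\<open>T = \<integral> x dE(x)\<close> for a self-adjoint \<open>T\<close> of norm at most one. On a complex Hilbert space a
  bounded operator is determined by its diagonal form \<open>\<langle>Tf, f\<rangle>\<close>, so it suffices to integrate
  against the measures \<open>\<langle>E(\<cdot>)f, f\<rangle>\<close>.\<close>

definition spectral_resolution ::
    "'a set \<Rightarrow> (('a \<Rightarrow> complex) \<Rightarrow> ('a \<Rightarrow> complex)) \<Rightarrow>
     (real set \<Rightarrow> ('a \<Rightarrow> complex) \<Rightarrow> ('a \<Rightarrow> complex)) \<Rightarrow> bool"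
  where "spectral_resolution A T E \<longleftrightarrow>
    projection_valued_measure A borel_unit E \<and>
    (\<forall>f\<in>l2 A. l2_inner A (T f) f = complex_of_real (\<integral>x. x \<partial>(scalar_measure A borel_unit E f)))"

section \<open>Random walks\<close>

definition markov_operator ::
    "('a, 'b) monoid_scheme \<Rightarrow> 'a set \<Rightarrow> ('a \<Rightarrow> complex) \<Rightarrow> ('a \<Rightarrow> complex)"
  where "markov_operator \<Lambda> S f =
    (\<lambda>g. if g \<in> carrier \<Lambda> then (\<Sum>s\<in>S. f (s \<otimes>\<^bsub>\<Lambda>\<^esub> g)) / of_nat (card S) else 0)"

text \<open>By the spectral theorem the resolution \<open>E\<close> of the Markov operator exists, and its values on
  Borel sets and square-summable functions are unique; the choice operator only fixes the
  irrelevant values elsewhere.\<close>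

definition kesten_spectral_measure :: "('a, 'b) monoid_scheme \<Rightarrow> 'a set \<Rightarrow> real measure"
  where "kesten_spectral_measure \<Lambda> S =
    scalar_measure (carrier \<Lambda>) borel_unit
      (SOME E. spectral_resolution (carrier \<Lambda>) (markov_operator \<Lambda> S) E)
      (\<lambda>g. if g = \<one>\<^bsub>\<Lambda>\<^esub> then 1 else 0)"

section \<open>The wreath product is a group with finite symmetric generating set\<close>

lemma carrier_wreath_int:
  assumes "group G"
  shows "carrier (wreath_int G) =
    {f. (\<forall>i. f i \<in> carrier G) \<and> finite {i. f i \<noteq> \<one>\<^bsub>G\<^esub>}} \<times> UNIV"
  using assms
  by (auto simp: wreath_int_def semidirect_product_def carrier_sum_group integer_group_def PiE_iff)

lemma mult_wreath_int:
  "x \<otimes>\<^bsub>wreath_int G\<^esub> y = ((\<lambda>i. fst x i \<otimes>\<^bsub>G\<^esub> fst y (i - snd x)), snd x + snd y)"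
  by (simp add: wreath_int_def semidirect_product_def shift_def integer_group_def split_beta
        restrict_def)

lemma one_wreath_int: "\<one>\<^bsub>wreath_int G\<^esub> = ((\<lambda>_. \<one>\<^bsub>G\<^esub>), 0)"
  by (simp add: wreath_int_def semidirect_product_def integer_group_def restrict_def)

lemma finite_shift_support:
  assumes "finite {i::int. f i \<noteq> e}" shows "finite {i. f (i - k) \<noteq> e}"
proof -
  have "{i. f (i - k) \<noteq> e} = (\<lambda>i. i + k) ` {i. f i \<noteq> e}"
    by (auto simp: image_iff intro!: exI[of _ "_ - k"])
  then show ?thesis using assms by simp
qed

lemma group_wreath_int:
  assumes "group G" shows "group (wreath_int G)"
proof -
  interpret group G by fact
  show ?thesis
  proof (rule groupI)
    fix x y assume "x \<in> carrier (wreath_int G)" "y \<in> carrier (wreath_int G)"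
    then obtain f k h l where x: "x = (f, k)" "\<forall>i. f i \<in> carrier G" "finite {i. f i \<noteq> \<one>\<^bsub>G\<^esub>}"
      and y: "y = (h, l)" "\<forall>i. h i \<in> carrier G" "finite {i. h i \<noteq> \<one>\<^bsub>G\<^esub>}"
      by (auto simp: carrier_wreath_int[OF assms])
    have "finite ({i. f i \<noteq> \<one>\<^bsub>G\<^esub>} \<union> {i. h (i - k) \<noteq> \<one>\<^bsub>G\<^esub>})"
      using x(3) finite_shift_support[OF y(3), of k] by (rule finite_UnI)
    then have "finite {i. f i \<otimes>\<^bsub>G\<^esub> h (i - k) \<noteq> \<one>\<^bsub>G\<^esub>}"
      by (rule rev_finite_subset) auto
    then show "x \<otimes>\<^bsub>wreath_int G\<^esub> y \<in> carrier (wreath_int G)"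
      using x y by (auto simp: carrier_wreath_int[OF assms] mult_wreath_int)
  next
    show "\<one>\<^bsub>wreath_int G\<^esub> \<in> carrier (wreath_int G)"
      by (simp add: carrier_wreath_int[OF assms] one_wreath_int)
  next
    fix x y z assume "x \<in> carrier (wreath_int G)" "y \<in> carrier (wreath_int G)"
      "z \<in> carrier (wreath_int G)"
    then show "x \<otimes>\<^bsub>wreath_int G\<^esub> y \<otimes>\<^bsub>wreath_int G\<^esub> z = x \<otimes>\<^bsub>wreath_int G\<^esub> (y \<otimes>\<^bsub>wreath_int G\<^esub> z)"
      by (auto simp: carrier_wreath_int[OF assms] mult_wreath_int m_assoc diff_diff_eq)
  next
    fix x assume "x \<in> carrier (wreath_int G)"
    then show "\<one>\<^bsub>wreath_int G\<^esub> \<otimes>\<^bsub>wreath_int G\<^esub> x = x"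
      by (auto simp: carrier_wreath_int[OF assms] mult_wreath_int one_wreath_int)
  next
    fix x assume "x \<in> carrier (wreath_int G)"
    then obtain f k where x: "x = (f, k)" "\<forall>i. f i \<in> carrier G" "finite {i. f i \<noteq> \<one>\<^bsub>G\<^esub>}"
      by (auto simp: carrier_wreath_int[OF assms])
    let ?y = "((\<lambda>i. inv\<^bsub>G\<^esub> f (i + k)), - k)"
    have "finite {i. inv\<^bsub>G\<^esub> f (i + k) \<noteq> \<one>\<^bsub>G\<^esub>}"
      using finite_shift_support[OF x(3), of "- k"] x(2) by (simp add: inv_eq_1_iff)
    then have "?y \<in> carrier (wreath_int G)"
      using x by (auto simp: carrier_wreath_int[OF assms])
    moreover have "?y \<otimes>\<^bsub>wreath_int G\<^esub> x = \<one>\<^bsub>wreath_int G\<^esub>"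
      using x by (auto simp: mult_wreath_int one_wreath_int)
    ultimately show "\<exists>y\<in>carrier (wreath_int G). y \<otimes>\<^bsub>wreath_int G\<^esub> x = \<one>\<^bsub>wreath_int G\<^esub>" ..
  qed
qed

lemma wreath_embed_closed:
  assumes "group G" "g \<in> carrier G" shows "wreath_embed G g \<in> carrier (wreath_int G)"
proof -
  interpret group G by fact
  have "finite {i::int. (if i = 0 then g else \<one>\<^bsub>G\<^esub>) \<noteq> \<one>\<^bsub>G\<^esub>}"
    by (rule finite_subset[of _ "{0}"]) auto
  then show ?thesis using assms(2)
    by (simp add: carrier_wreath_int[OF assms(1)] wreath_embed_def)
qed

lemma wreath_t_closed:
  assumes "group G" shows "wreath_t G \<in> carrier (wreath_int G)"
  using assms by (simp add: carrier_wreath_int wreath_t_def group.is_monoid)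

lemma wreath_embed_inv:
  assumes "group G" "g \<in> carrier G"
  shows "inv\<^bsub>wreath_int G\<^esub> wreath_embed G g = wreath_embed G (inv\<^bsub>G\<^esub> g)"
proof -
  interpret group G by fact
  interpret W: group "wreath_int G" by (rule group_wreath_int) fact
  have "wreath_embed G (inv\<^bsub>G\<^esub> g) \<otimes>\<^bsub>wreath_int G\<^esub> wreath_embed G g = \<one>\<^bsub>wreath_int G\<^esub>"
    using assms(2) by (auto simp: mult_wreath_int one_wreath_int wreath_embed_def)
  then show ?thesis
    by (rule W.inv_equality) (use assms in \<open>auto intro: wreath_embed_closed\<close>)
qed

lemma wreath_gens_subset:
  assumes "group G" shows "wreath_gens G \<subseteq> carrier (wreath_int G)"
proof -
  interpret W: group "wreath_int G" by (rule group_wreath_int) fact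
  show ?thesis
    using assms by (auto simp: wreath_gens_def wreath_embed_closed wreath_t_closed)
qed

lemma finite_wreath_gens: "finite (carrier G) \<Longrightarrow> finite (wreath_gens G)"
  by (simp add: wreath_gens_def Setcompr_eq_image)

lemma wreath_gens_symmetric:
  assumes "group G" "s \<in> wreath_gens G" shows "inv\<^bsub>wreath_int G\<^esub> s \<in> wreath_gens G"
proof -
  interpret group G by fact
  interpret W: group "wreath_int G" by (rule group_wreath_int) fact
  show ?thesis
    using assms(2) unfolding wreath_gens_def
    by (auto simp: W.inv_mult_group wreath_embed_closed wreath_t_closed wreath_embed_inv assms(1)
        intro: inv_closed)
qed

lemma generate_wreath_gens:
  assumes "group G" shows "generate (wreath_int G) (wreath_gens G) = carrier (wreath_int G)"
proof -
  interpret group G by fact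
  interpret W: group "wreath_int G" by (rule group_wreath_int) fact
  let ?W = "wreath_int G" and ?t = "wreath_t G"
  define D where "D = generate ?W (wreath_gens G)"
  interpret D: subgroup D ?W
    unfolding D_def using wreath_gens_subset[OF assms] by (rule W.generate_is_subgroup)
  note [simp] = wreath_t_closed[OF assms] wreath_embed_closed[OF assms]
  have tg: "?t \<otimes>\<^bsub>?W\<^esub> wreath_embed G g \<in> D" if "g \<in> carrier G" for g
    unfolding D_def by (rule generate.incl) (use that in \<open>auto simp: wreath_gens_def\<close>)
  have "wreath_embed G \<one>\<^bsub>G\<^esub> = \<one>\<^bsub>?W\<^esub>"
    by (simp add: wreath_embed_def one_wreath_int)
  then have t: "?t \<in> D" using tg[of "\<one>\<^bsub>G\<^esub>"] by simp
  have g: "wreath_embed G g \<in> D" if "g \<in> carrier G" for g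
  proof -
    have "inv\<^bsub>?W\<^esub> ?t \<otimes>\<^bsub>?W\<^esub> (?t \<otimes>\<^bsub>?W\<^esub> wreath_embed G g) \<in> D"
      using t tg[OF that] by simp
    then show ?thesis using that by (simp add: W.m_assoc[symmetric])
  qed
  have t_inv: "inv\<^bsub>?W\<^esub> ?t = ((\<lambda>_. \<one>\<^bsub>G\<^esub>), -1)"
    by (rule W.inv_equality)
      (auto simp: mult_wreath_int one_wreath_int wreath_t_def carrier_wreath_int[OF assms])
  have tk: "((\<lambda>_. \<one>\<^bsub>G\<^esub>), k) \<in> D" for k :: int
  proof (induction k rule: int_induct[where k = 0])
    case base
    then show ?case using D.one_closed by (simp add: one_wreath_int)
  next
    case (step1 i)
    then show ?case using D.m_closed[OF step1(2) t]
      by (simp add: mult_wreath_int wreath_t_def)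
  next
    case (step2 i)
    then show ?case using D.m_closed[OF step2(2) D.m_inv_closed[OF t]]
      by (simp add: mult_wreath_int t_inv)
  qed
  have conj: "((\<lambda>i. if i = k then g else \<one>\<^bsub>G\<^esub>), 0) \<in> D" if "g \<in> carrier G" for g and k :: int
  proof -
    have "((\<lambda>_. \<one>\<^bsub>G\<^esub>), k) \<otimes>\<^bsub>?W\<^esub> wreath_embed G g \<otimes>\<^bsub>?W\<^esub> ((\<lambda>_. \<one>\<^bsub>G\<^esub>), -k) \<in> D"
      using tk g[OF that] by simp
    moreover have "(\<lambda>i. (\<one>\<^bsub>G\<^esub> \<otimes>\<^bsub>G\<^esub> (if i - k = 0 then g else \<one>\<^bsub>G\<^esub>)) \<otimes>\<^bsub>G\<^esub> \<one>\<^bsub>G\<^esub>) =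
        (\<lambda>i. if i = k then g else \<one>\<^bsub>G\<^esub>)"
      using that by auto
    ultimately show ?thesis by (simp add: mult_wreath_int wreath_embed_def)
  qed
  have base: "(f, 0) \<in> D"
    if "finite A" "{i. f i \<noteq> \<one>\<^bsub>G\<^esub>} \<subseteq> A" "\<forall>i. f i \<in> carrier G" for f and A :: "int set"
    using that
  proof (induction A arbitrary: f rule: finite_induct)
    case empty
    then have "f = (\<lambda>_. \<one>\<^bsub>G\<^esub>)" by auto
    then show ?case using tk by simp
  next
    case (insert a A)
    have "(f(a := \<one>\<^bsub>G\<^esub>), 0) \<in> D"
      by (rule insert.IH) (use insert.prems in auto)
    from D.m_closed[OF this conj[of "f a" a]]
    have "((\<lambda>i. (f(a := \<one>\<^bsub>G\<^esub>)) i \<otimes>\<^bsub>G\<^esub> (if i = a then f a else \<one>\<^bsub>G\<^esub>)), 0) \<in> D"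
      using insert.prems by (simp add: mult_wreath_int)
    moreover have "(\<lambda>i. (f(a := \<one>\<^bsub>G\<^esub>)) i \<otimes>\<^bsub>G\<^esub> (if i = a then f a else \<one>\<^bsub>G\<^esub>)) = f"
      using insert.prems by auto
    ultimately show ?case by simp
  qed
  have "x \<in> D" if xW: "x \<in> carrier ?W" for x
  proof -
    obtain f k where x: "x = (f, k)" "\<forall>i. f i \<in> carrier G" "finite {i. f i \<noteq> \<one>\<^bsub>G\<^esub>}"
      using xW by (auto simp: carrier_wreath_int[OF assms])
    have "(f, 0) \<otimes>\<^bsub>?W\<^esub> ((\<lambda>_. \<one>\<^bsub>G\<^esub>), k) \<in> D"
      using base[OF x(3) subset_refl x(2)] tk by simp
    then show ?thesis using x by (simp add: mult_wreath_int)
  qed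
  then show ?thesis using D.subset unfolding D_def by auto
qed

end

(*
  Put the walker on a line whose edges carry the lamps: a step along an edge replaces the lamp of that
  edge by a uniformly random element of G. At each lamp write the point mass at 1 as u + v with
  u = 1/n constant and v of mean zero. Averaging fixes u and kills v, so a product function with
  v at two edges, u at the edges in between and point masses elsewhere confines the walker to the
  segment between the two edges, where the Markov operator acts as half the adjacency operator of a path
  with Q - 1 vertices. Its eigenvalues are cos (k pi / Q), with sine eigenvectors. The point mass at the
  identity is the sum of these product functions over all segments containing 0; the segments with
  parameter Q contribute (n-1)^2 n^(-Q) at each cos (k pi / Q), and reducing the fractions k / Q gives
  geometric series with sum 1 / (n^q - 1).

  Since right translations commute with the walk, the eigenvectors are total in l2. This yields
  a spectral resolution without the general spectral theorem, and any spectral resolution acts on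
  eigenvectors in the expected way, which determines the measure.
*)
theory Submission
  imports Defs
begin

section \<open>The Hilbert space of square-summable functions\<close>

text \<open>The measure is defined from a resolution picked by choice, so existence of a resolution
  has to be shown as well as the behaviour of an arbitrary one. The sum over segments is a
  telescope: v at an end is the point mass minus u, so summing over all segments from -a to b with
  a, b up to N leaves the point mass at the identity and three remainders that are uniform on long
  stretches of lamps. A remainder uniform on r lamps has norm n^(-r/2), which tends to 0 because n
  \<ge> 2. The constant (n-1)^2 n^(-Q) is a value at the identity: a path with Q - 1 vertices has Q
  - 2 inner edges, each contributing 1/n, and two bounding edges, each contributing 1 - 1/n. The
  vertex 0 can occupy any of the Q - 1 positions, and the squared entries of a normalised sine
  eigenvector add up to 1 over these positions, so every eigenvalue of the path receives the same
  mass.\<close>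

typedef 'a ell2 = "{f :: 'a \<Rightarrow> complex. (\<lambda>x. (cmod (f x))\<^sup>2) summable_on UNIV}"
  morphisms ell2_fun Abs_ell2
  by (rule exI[of _ "\<lambda>_. 0"]) simp

setup_lifting type_definition_ell2

lemma square_summable_add:
  fixes f g :: "'a \<Rightarrow> complex"
  assumes "(\<lambda>x. (cmod (f x))\<^sup>2) summable_on A" "(\<lambda>x. (cmod (g x))\<^sup>2) summable_on A"
  shows "(\<lambda>x. (cmod (f x + g x))\<^sup>2) summable_on A"
proof (rule summable_on_comparison_test)
  show "(\<lambda>x. 2 * (cmod (f x))\<^sup>2 + 2 * (cmod (g x))\<^sup>2) summable_on A"
    by (intro summable_on_add summable_on_cmult_right assms)
  have "(cmod (f x + g x))\<^sup>2 \<le> (cmod (f x) + cmod (g x))\<^sup>2" for x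
    by (intro power_mono norm_triangle_ineq) auto
  also have "(cmod (f x) + cmod (g x))\<^sup>2 \<le> 2 * (cmod (f x))\<^sup>2 + 2 * (cmod (g x))\<^sup>2" for x
    using zero_le_power2[of "cmod (f x) - cmod (g x)"] by (simp add: power2_eq_square algebra_simps)
  finally show "(cmod (f x + g x))\<^sup>2 \<le> 2 * (cmod (f x))\<^sup>2 + 2 * (cmod (g x))\<^sup>2" for x .
qed auto

lemma square_summable_scale:
  fixes f :: "'a \<Rightarrow> complex"
  assumes "(\<lambda>x. (cmod (f x))\<^sup>2) summable_on A"
  shows "(\<lambda>x. (cmod (c * f x))\<^sup>2) summable_on A"
  using summable_on_cmult_right[OF assms, of "(cmod c)\<^sup>2"] by (simp add: norm_mult power_mult_distrib)

lemma square_summable_inner: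
  fixes f g :: "'a \<Rightarrow> complex"
  assumes "(\<lambda>x. (cmod (f x))\<^sup>2) summable_on A" "(\<lambda>x. (cmod (g x))\<^sup>2) summable_on A"
  shows "(\<lambda>x. f x \<bullet> g x) summable_on A"
proof (rule abs_summable_summable[OF Infinite_Sum.abs_summable_on_comparison_test'])
  show "(\<lambda>x. (cmod (f x))\<^sup>2 + (cmod (g x))\<^sup>2) summable_on A"
    by (intro summable_on_add assms)
  show "norm (f x \<bullet> g x) \<le> (cmod (f x))\<^sup>2 + (cmod (g x))\<^sup>2" for x
  proof -
    have "norm (f x \<bullet> g x) \<le> cmod (f x) * cmod (g x)"
      using Cauchy_Schwarz_ineq2 by auto
    also have "\<dots> \<le> (cmod (f x))\<^sup>2 + (cmod (g x))\<^sup>2"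
      using sum_squares_bound[of "cmod (f x)" "cmod (g x)"]
        mult_nonneg_nonneg[OF norm_ge_zero[of "f x"] norm_ge_zero[of "g x"]] by linarith
    finally show ?thesis .
  qed
qed

instantiation ell2 :: (type) real_vector
begin

lift_definition zero_ell2 :: "'a ell2" is "\<lambda>_. 0" by simp

lift_definition plus_ell2 :: "'a ell2 \<Rightarrow> 'a ell2 \<Rightarrow> 'a ell2" is "\<lambda>f g x. f x + g x"
  by (rule square_summable_add)

lift_definition uminus_ell2 :: "'a ell2 \<Rightarrow> 'a ell2" is "\<lambda>f x. - f x" by simp

lift_definition minus_ell2 :: "'a ell2 \<Rightarrow> 'a ell2 \<Rightarrow> 'a ell2" is "\<lambda>f g x. f x - g x"
  using square_summable_add[where g = "\<lambda>x. - _ x"] by (metis (no_types, lifting) diff_conv_add_uminus norm_minus_cancel summable_on_cong)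

lift_definition scaleR_ell2 :: "real \<Rightarrow> 'a ell2 \<Rightarrow> 'a ell2" is "\<lambda>r f x. r *\<^sub>R f x"
  using square_summable_scale by (simp add: scaleR_conv_of_real)

instance
  by standard (transfer; auto simp: algebra_simps)+

end

instantiation ell2 :: (type) real_inner
begin

text \<open>The real part of the complex inner product, since \<open>\<bullet>\<close> on complex
  numbers is the real part of z times the conjugate of w.\<close>

definition inner_ell2 :: "'a ell2 \<Rightarrow> 'a ell2 \<Rightarrow> real"
  where "inner_ell2 f g = (\<Sum>\<^sub>\<infinity>x. ell2_fun f x \<bullet> ell2_fun g x)"

definition norm_ell2 :: "'a ell2 \<Rightarrow> real" where "norm_ell2 f = sqrt (f \<bullet> f)"
definition sgn_ell2 :: "'a ell2 \<Rightarrow> 'a ell2" where "sgn_ell2 f = f /\<^sub>R norm f"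
definition dist_ell2 :: "'a ell2 \<Rightarrow> 'a ell2 \<Rightarrow> real" where "dist_ell2 f g = norm (f - g)"
definition uniformity_ell2 :: "('a ell2 \<times> 'a ell2) filter"
  where "uniformity_ell2 = (INF e\<in>{0<..}. principal {(x, y). dist x y < e})"
definition open_ell2 :: "'a ell2 set \<Rightarrow> bool"
  where "open_ell2 U \<longleftrightarrow> (\<forall>x\<in>U. eventually (\<lambda>(x', y). x' = x \<longrightarrow> y \<in> U) uniformity)"

instance
proof
  fix f g h :: "'a ell2" and r s :: real
  have sm: "(\<lambda>x. ell2_fun f x \<bullet> ell2_fun g x) summable_on UNIV" for f g :: "'a ell2"
    using ell2_fun[of f] ell2_fun[of g] by (intro square_summable_inner) auto
  show "dist f g = norm (f - g)" "sgn f = f /\<^sub>R norm f" "norm f = sqrt (f \<bullet> f)"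
    "uniformity = (INF e\<in>{0<..}. principal {(x, y). dist x (y::'a ell2) < e})"
    "open U \<longleftrightarrow> (\<forall>x\<in>U. eventually (\<lambda>(x', y). x' = x \<longrightarrow> y \<in> U) uniformity)" for U :: "'a ell2 set"
    by (simp_all only: dist_ell2_def norm_ell2_def sgn_ell2_def uniformity_ell2_def open_ell2_def)
  show "f \<bullet> g = g \<bullet> f"
    by (simp add: inner_ell2_def inner_commute)
  show "(f + g) \<bullet> h = f \<bullet> h + g \<bullet> h"
    using infsum_add[OF sm[of f h] sm[of g h]]
    by (simp add: inner_ell2_def plus_ell2.rep_eq inner_add_left)
  show "r *\<^sub>R f \<bullet> g = r * (f \<bullet> g)"
    using infsum_cmult_right'[of r "\<lambda>x. ell2_fun f x \<bullet> ell2_fun g x" UNIV]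
    by (simp add: inner_ell2_def scaleR_ell2.rep_eq)
  show "0 \<le> f \<bullet> f"
    unfolding inner_ell2_def by (rule infsum_nonneg) simp
  show "f \<bullet> f = 0 \<longleftrightarrow> f = 0"
  proof
    assume "f \<bullet> f = 0"
    then have "(\<Sum>\<^sub>\<infinity>x. ell2_fun f x \<bullet> ell2_fun f x) \<le> 0" by (simp add: inner_ell2_def)
    then have "ell2_fun f x \<bullet> ell2_fun f x = 0" for x
      by (rule nonneg_infsum_le_0D) (use sm in auto)
    then have "ell2_fun f x = 0" for x by simp
    then show "f = 0" by transfer auto
  next
    assume "f = 0"
    then show "f \<bullet> f = 0" by (simp add: inner_ell2_def zero_ell2.rep_eq)
  qed
qed

end

lemma ell2_inner_has_sum: "((\<lambda>x. ell2_fun f x \<bullet> ell2_fun g x) has_sum f \<bullet> g) UNIV"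
  unfolding inner_ell2_def using ell2_fun[of f] ell2_fun[of g]
  by (intro has_sum_infsum square_summable_inner) auto

lemma ell2_norm_has_sum: "((\<lambda>x. (cmod (ell2_fun f x))\<^sup>2) has_sum (norm f)\<^sup>2) UNIV"
  using ell2_inner_has_sum[of f f] by (simp add: power2_norm_eq_inner)

lemma ell2_sum_le_norm:
  assumes "finite F" shows "(\<Sum>x\<in>F. (cmod (ell2_fun f x))\<^sup>2) \<le> (norm f)\<^sup>2"
  by (rule finite_sum_le_has_sum[OF ell2_norm_has_sum]) (use assms in auto)

lemma ell2_cmod_le_norm: "cmod (ell2_fun f x) \<le> norm f"
  by (rule power2_le_imp_le) (use ell2_sum_le_norm[of "{x}" f] in auto)

lemma ell2_fun_sum: "ell2_fun (\<Sum>i\<in>I. f i) x = (\<Sum>i\<in>I. ell2_fun (f i) x)"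
  by (induction I rule: infinite_finite_induct) (auto simp: zero_ell2.rep_eq plus_ell2.rep_eq)

text \<open>Coordinates are bounded by the norm, so a Cauchy sequence converges pointwise. A bound
  on finite sums of squared differences survives the limit, which gives both square-summability of
  the limit and convergence in norm.\<close>

instance ell2 :: (type) complete_space
proof
  fix X :: "nat \<Rightarrow> 'a ell2" assume X: "Cauchy X"
  have "Cauchy (\<lambda>n. ell2_fun (X n) x)" for x
  proof (rule metric_CauchyI)
    fix e :: real assume "0 < e"
    with X obtain M where M: "dist (X m) (X n) < e" if "m \<ge> M" "n \<ge> M" for m n
      by (meson metric_CauchyD)
    have "dist (ell2_fun (X m) x) (ell2_fun (X n) x) \<le> dist (X m) (X n)" for m n
      using ell2_cmod_le_norm[of "X m - X n" x] by (simp add: dist_norm minus_ell2.rep_eq)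
    then show "\<exists>M. \<forall>m\<ge>M. \<forall>n\<ge>M. dist (ell2_fun (X m) x) (ell2_fun (X n) x) < e"
      using M by (meson le_less_trans)
  qed
  then have "\<exists>l. \<forall>x. (\<lambda>n. ell2_fun (X n) x) \<longlonglongrightarrow> l x"
    by (intro choice allI) (simp add: Cauchy_convergent_iff convergent_def)
  then obtain l where l: "(\<lambda>n. ell2_fun (X n) x) \<longlonglongrightarrow> l x" for x
    by blast
  have bound: "(\<Sum>x\<in>F. (cmod (ell2_fun (X m) x - l x))\<^sup>2) \<le> e\<^sup>2"
    if "finite F" "\<And>n. n \<ge> M \<Longrightarrow> norm (X m - X n) \<le> e" for F m M e
  proof (rule tendsto_upperbound)
    show "(\<lambda>n. \<Sum>x\<in>F. (cmod (ell2_fun (X m) x - ell2_fun (X n) x))\<^sup>2)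
        \<longlonglongrightarrow> (\<Sum>x\<in>F. (cmod (ell2_fun (X m) x - l x))\<^sup>2)"
      by (intro tendsto_intros l)
    have "(\<Sum>x\<in>F. (cmod (ell2_fun (X m) x - ell2_fun (X n) x))\<^sup>2) \<le> e\<^sup>2" if "n \<ge> M" for n
    proof -
      have "(\<Sum>x\<in>F. (cmod (ell2_fun (X m) x - ell2_fun (X n) x))\<^sup>2) \<le> (norm (X m - X n))\<^sup>2"
        using ell2_sum_le_norm[OF \<open>finite F\<close>, of "X m - X n"] by (simp add: minus_ell2.rep_eq)
      also have "\<dots> \<le> e\<^sup>2" using \<open>n \<ge> M \<Longrightarrow> _\<close> that by (intro power_mono) auto
      finally show ?thesis .
    qed
    then show "\<forall>\<^sub>F n in sequentially. (\<Sum>x\<in>F. (cmod (ell2_fun (X m) x - ell2_fun (X n) x))\<^sup>2) \<le> e\<^sup>2"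
      by (auto simp: eventually_sequentially)
  qed simp
  have ex: "\<exists>M. \<forall>m\<ge>M. \<forall>n\<ge>M. norm (X m - X n) \<le> e" if "e > 0" for e
    using X that by (metis dist_norm less_imp_le metric_CauchyD)
  obtain M1 where M1: "\<And>m n. m \<ge> M1 \<Longrightarrow> n \<ge> M1 \<Longrightarrow> norm (X m - X n) \<le> 1"
    using ex[of 1] by auto
  have sub: "(\<lambda>x. (cmod (ell2_fun (X m) x - l x))\<^sup>2) summable_on UNIV"
    if "\<And>n. n \<ge> M \<Longrightarrow> norm (X m - X n) \<le> e" for M m e
    by (rule nonneg_bdd_above_summable_on)
      (auto intro!: bdd_aboveI2[of _ _ "e\<^sup>2"] bound[OF _ that])
  have "(\<lambda>x. (cmod (ell2_fun (X M1) x + - (ell2_fun (X M1) x - l x)))\<^sup>2) summable_on UNIV"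
    by (rule square_summable_add)
      (use sub[OF M1[of M1], of M1] ell2_fun[of "X M1"] in \<open>auto simp: norm_minus_commute\<close>)
  then have ls: "(\<lambda>x. (cmod (l x))\<^sup>2) summable_on UNIV" by simp
  have "X \<longlonglongrightarrow> Abs_ell2 l"
  proof (rule LIMSEQ_I)
    fix e :: real assume "e > 0"
    then obtain M where M: "\<And>m n. m \<ge> M \<Longrightarrow> n \<ge> M \<Longrightarrow> norm (X m - X n) \<le> e/2"
      using ex[of "e/2"] by auto
    have "norm (X m - Abs_ell2 l) < e" if m: "m \<ge> M" for m
    proof -
      have "(norm (X m - Abs_ell2 l))\<^sup>2 \<le> (e/2)\<^sup>2"
      proof (rule has_sum_le_finite_sums[OF ell2_norm_has_sum])
        fix F :: "'a set" assume "finite F"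
        then show "(\<Sum>x\<in>F. (cmod (ell2_fun (X m - Abs_ell2 l) x))\<^sup>2) \<le> (e/2)\<^sup>2"
          using bound[of F M m "e/2"] M m ls by (simp add: minus_ell2.rep_eq Abs_ell2_inverse)
      qed
      then have "norm (X m - Abs_ell2 l) \<le> e/2" by (rule power2_le_imp_le) (use \<open>e > 0\<close> in simp)
      then show ?thesis using \<open>e > 0\<close> by simp
    qed
    then show "\<exists>no. \<forall>n\<ge>no. norm (X n - Abs_ell2 l) < e" by blast
  qed
  then show "convergent X" by (auto simp: convergent_def)
qed

section \<open>Symmetric operators with a total set of eigenvectors\<close>

lemma subspace_closure:
  fixes S :: "'a::real_normed_vector set"
  assumes "subspace S" shows "subspace (closure S)"
proof (rule subspaceI)
  show "0 \<in> closure S" using subspace_0[OF assms] closure_subset by blast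
next
  fix x y assume "x \<in> closure S" "y \<in> closure S"
  then obtain X Y where "\<forall>n. X n \<in> S" "X \<longlonglongrightarrow> x" "\<forall>n. Y n \<in> S" "Y \<longlonglongrightarrow> y"
    by (auto simp: closure_sequential)
  then show "x + y \<in> closure S"
    unfolding closure_sequential
    by (intro exI[of _ "\<lambda>n. X n + Y n"]) (auto simp: subspace_add assms intro: tendsto_add)
next
  fix c x assume "x \<in> closure S"
  then obtain X where "\<forall>n. X n \<in> S" "X \<longlonglongrightarrow> x"
    by (auto simp: closure_sequential)
  then show "c *\<^sub>R x \<in> closure S"
    unfolding closure_sequential
    by (intro exI[of _ "\<lambda>n. c *\<^sub>R X n"])
      (auto simp: subspace_scale assms intro: tendsto_scaleR)
qed

locale pure_point_operator =
  fixes T :: "'a::{real_inner,complete_space} \<Rightarrow> 'a"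
  assumes bounded_linear_T: "bounded_linear T"
    and T_sym: "T x \<bullet> y = x \<bullet> T y"
    and total: "closure (span {x. \<exists>l. T x = l *\<^sub>R x}) = UNIV"
begin

text \<open>\<open>B\<close> is an arbitrary set of reals: for pure point spectrum no measurability
  is involved in the spectral subspaces.\<close>

definition eigenspaces :: "real set \<Rightarrow> 'a set"
  where "eigenspaces B = closure (span {x. \<exists>l\<in>B. T x = l *\<^sub>R x})"

text \<open>The working principle of this locale: a property stable under linear combinations and
  limits need only be checked on eigenvectors.\<close>

lemma total_induct:
  assumes "subspace S" "closed S" "\<And>x l. T x = l *\<^sub>R x \<Longrightarrow> x \<in> S"
  shows "x \<in> S"
proof -
  have "closure (span {x. \<exists>l. T x = l *\<^sub>R x}) \<subseteq> S"
    by (intro closure_minimal span_minimal) (use assms in auto)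
  with total show ?thesis by auto
qed

lemma eigenvectors_orthogonal:
  assumes "T x = l *\<^sub>R x" "T y = m *\<^sub>R y" "l \<noteq> m" shows "x \<bullet> y = 0"
  using T_sym[of x y] assms by simp

lemma subspace_eigenspaces: "subspace (eigenspaces B)"
  by (simp add: eigenspaces_def subspace_closure)

lemma closed_eigenspaces: "closed (eigenspaces B)"
  by (simp add: eigenspaces_def)

lemma eigenvector_in_eigenspaces: "T x = l *\<^sub>R x \<Longrightarrow> l \<in> B \<Longrightarrow> x \<in> eigenspaces B"
  unfolding eigenspaces_def using closure_subset by (fastforce intro: span_base)

lemma eigenvector_orthogonal_eigenspaces:
  assumes "T x = l *\<^sub>R x" "l \<notin> B" "z \<in> eigenspaces B" shows "x \<bullet> z = 0"
proof -
  have "eigenspaces B \<subseteq> {z. x \<bullet> z = 0}"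
    unfolding eigenspaces_def
  proof (intro closure_minimal span_minimal)
    show "{z. \<exists>l\<in>B. T z = l *\<^sub>R z} \<subseteq> {z. x \<bullet> z = 0}"
      using assms eigenvectors_orthogonal by blast
    show "subspace {z. x \<bullet> z = 0}" by (auto simp: subspace_def inner_add_right)
    show "closed {z. x \<bullet> z = 0}" by (intro closed_Collect_eq continuous_intros)
  qed
  with assms show ?thesis by auto
qed

definition proj :: "real set \<Rightarrow> 'a \<Rightarrow> 'a"
  where "proj B x = (THE y. y \<in> eigenspaces B \<and> (\<forall>z\<in>eigenspaces B. (x - y) \<bullet> z = 0))"

lemma proj_unique:
  assumes "y \<in> eigenspaces B" "\<And>z. z \<in> eigenspaces B \<Longrightarrow> (x - y) \<bullet> z = 0"
    "y' \<in> eigenspaces B" "\<And>z. z \<in> eigenspaces B \<Longrightarrow> (x - y') \<bullet> z = 0"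
  shows "y = y'"
proof -
  have "y - y' \<in> eigenspaces B" using assms by (simp add: subspace_diff subspace_eigenspaces)
  with assms have "(x - y') \<bullet> (y - y') - (x - y) \<bullet> (y - y') = 0" by simp
  then have "(y - y') \<bullet> (y - y') = 0" by (simp add: inner_diff_left)
  then show ?thesis by simp
qed

text \<open>Projections are contractions, stated before their existence is known: applied to
  differences it makes the projections of a convergent sequence a Cauchy sequence.\<close>

lemma norm_le_of_orthogonal_diff:
  assumes "\<And>z. z \<in> eigenspaces B \<Longrightarrow> (x - y) \<bullet> z = 0"
    "y \<in> eigenspaces B"
  shows "norm y \<le> norm x"
proof -
  have "y \<bullet> y = x \<bullet> y" using assms(1)[OF assms(2)] by (simp add: inner_diff_left)
  also have "\<dots> \<le> norm x * norm y" by (rule norm_cauchy_schwarz)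
  finally show ?thesis
    by (cases "y = 0") (simp_all add: dot_square_norm power2_eq_square)
qed

text \<open>The set of points that have an orthogonal projection onto a closed subspace is itself a closed
  subspace, because projections are contractions; so it suffices to project eigenvectors.\<close>

lemma proj_ex: "\<exists>y. y \<in> eigenspaces B \<and> (\<forall>z\<in>eigenspaces B. (x - y) \<bullet> z = 0)"
proof -
  let ?K = "eigenspaces B"
  let ?D = "{x. \<exists>y. y \<in> ?K \<and> (\<forall>z\<in>?K. (x - y) \<bullet> z = 0)}"
  have "x \<in> ?D"
  proof (rule total_induct)
    show "subspace ?D"
    proof (rule subspaceI)
      show "0 \<in> ?D" using subspace_0[OF subspace_eigenspaces] by (auto intro!: exI[of _ 0])
    next
      fix x x' assume "x \<in> ?D" "x' \<in> ?D"
      then obtain y y' where "y \<in> ?K" "\<forall>z\<in>?K. (x - y) \<bullet> z = 0" "y' \<in> ?K" "\<forall>z\<in>?K. (x' - y') \<bullet> z = 0"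
        by auto
      then show "x + x' \<in> ?D"
        by (intro CollectI exI[of _ "y + y'"])
          (auto simp: subspace_add subspace_eigenspaces inner_diff_left inner_add_left)
    next
      fix c x assume "x \<in> ?D"
      then obtain y where "y \<in> ?K" "\<forall>z\<in>?K. (x - y) \<bullet> z = 0" by auto
      then show "c *\<^sub>R x \<in> ?D"
        by (intro CollectI exI[of _ "c *\<^sub>R y"])
          (auto simp: subspace_scale subspace_eigenspaces inner_diff_left)
    qed
  next
    show "closed ?D"
    proof (unfold closed_sequential_limits, intro allI impI)
      fix X x assume "(\<forall>n. X n \<in> ?D) \<and> X \<longlonglongrightarrow> x"
      then have X: "X \<longlonglongrightarrow> x" and "\<forall>n. \<exists>y. y \<in> ?K \<and> (\<forall>z\<in>?K. (X n - y) \<bullet> z = 0)" by auto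
      then obtain Y where Y: "\<And>n. Y n \<in> ?K" "\<And>n z. z \<in> ?K \<Longrightarrow> (X n - Y n) \<bullet> z = 0"
        by metis
      have le: "norm (Y m - Y n) \<le> norm (X m - X n)" for m n
      proof (rule norm_le_of_orthogonal_diff)
        show "Y m - Y n \<in> ?K" using Y by (simp add: subspace_diff subspace_eigenspaces)
        show "(X m - X n - (Y m - Y n)) \<bullet> z = 0" if "z \<in> ?K" for z
          using Y(2)[OF that, of m] Y(2)[OF that, of n] by (simp add: inner_diff_left)
      qed
      have "Cauchy Y"
      proof (rule metric_CauchyI)
        fix e :: real assume "0 < e"
        then obtain M where M: "\<forall>m\<ge>M. \<forall>n\<ge>M. dist (X m) (X n) < e"
          using LIMSEQ_imp_Cauchy[OF X] by (meson metric_CauchyD)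
        have "dist (Y m) (Y n) \<le> dist (X m) (X n)" for m n
          using le[of m n] by (simp add: dist_norm)
        with M show "\<exists>M. \<forall>m\<ge>M. \<forall>n\<ge>M. dist (Y m) (Y n) < e" by (meson le_less_trans)
      qed
      then obtain y where y: "Y \<longlonglongrightarrow> y" by (auto simp: Cauchy_convergent_iff convergent_def)
      have "(x - y) \<bullet> z = 0" if "z \<in> ?K" for z
      proof (rule LIMSEQ_unique)
        show "(\<lambda>n. (X n - Y n) \<bullet> z) \<longlonglongrightarrow> (x - y) \<bullet> z" by (intro tendsto_intros X y)
        show "(\<lambda>n. (X n - Y n) \<bullet> z) \<longlonglongrightarrow> 0" using Y(2)[OF that] by simp
      qed
      moreover have "y \<in> ?K"
        by (rule closed_sequentially[OF closed_eigenspaces _ y]) (use Y in auto)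
      ultimately show "x \<in> ?D" by auto
    qed
  next
    \<comment> \<open>An eigenvector is its own projection if its eigenvalue lies in
      \<open>B\<close>; otherwise it is orthogonal to the subspace and projects to 0.\<close>
    fix x l assume "T x = l *\<^sub>R x"
    then show "x \<in> ?D"
      using eigenvector_in_eigenspaces[of x l B] eigenvector_orthogonal_eigenspaces[of x l B]
        subspace_0[OF subspace_eigenspaces]
      by (cases "l \<in> B") (auto intro: exI[of _ x] exI[of _ 0])
  qed
  then show ?thesis by simp
qed

lemma proj_in: "proj B x \<in> eigenspaces B"
  and proj_orth: "z \<in> eigenspaces B \<Longrightarrow> (x - proj B x) \<bullet> z = 0"
proof -
  have "\<exists>!y. y \<in> eigenspaces B \<and> (\<forall>z\<in>eigenspaces B. (x - y) \<bullet> z = 0)"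
    using proj_ex[of B x] proj_unique by blast
  from theI'[OF this, folded proj_def]
  show "proj B x \<in> eigenspaces B" "z \<in> eigenspaces B \<Longrightarrow> (x - proj B x) \<bullet> z = 0" by auto
qed

lemma proj_eqI:
  "y \<in> eigenspaces B \<Longrightarrow> (\<And>z. z \<in> eigenspaces B \<Longrightarrow> (x - y) \<bullet> z = 0) \<Longrightarrow> proj B x = y"
  using proj_unique proj_in proj_orth by blast

lemma norm_proj_le: "norm (proj B x) \<le> norm x"
  using norm_le_of_orthogonal_diff proj_in proj_orth by blast

lemma bounded_linear_proj: "bounded_linear (proj B)"
proof (rule bounded_linear_intro[where K = 1])
  show "proj B (x + y) = proj B x + proj B y" for x y
    using proj_orth[of _ B x] proj_orth[of _ B y]
    by (intro proj_eqI) (auto simp: subspace_add subspace_eigenspaces proj_in inner_diff_left inner_add_left)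
  show "proj B (r *\<^sub>R x) = r *\<^sub>R proj B x" for r x
    using proj_orth[of _ B x]
    by (intro proj_eqI) (auto simp: subspace_scale subspace_eigenspaces proj_in inner_diff_left)
  show "norm (proj B x) \<le> norm x * 1" for x using norm_proj_le[of B x] by simp
qed

lemmas proj_simps [simp] = linear_simps[OF bounded_linear_proj]

lemma proj_eigenvector:
  assumes "T x = l *\<^sub>R x" shows "proj B x = (if l \<in> B then x else 0)"
  using eigenvector_in_eigenspaces[OF assms, of B] eigenvector_orthogonal_eigenspaces[OF assms, of B]
    subspace_0[OF subspace_eigenspaces]
  by (auto intro!: proj_eqI)

text \<open>The quantifier over \<open>B\<close> lets a single destruction step evaluate all
  projections occurring in a goal.\<close>

lemma proj_eigenvector_all:
  "T x = l *\<^sub>R x \<Longrightarrow> \<forall>B. proj B x = (if l \<in> B then x else 0)"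
  by (simp add: proj_eigenvector)

text \<open>Reduces identities between spectral projections to a case distinction on whether an
  eigenvalue belongs to the sets involved.\<close>

lemma bounded_linear_eqI:
  fixes U V :: "'a \<Rightarrow> 'b::real_normed_vector"
  assumes "bounded_linear U" "bounded_linear V" "\<And>x l. T x = l *\<^sub>R x \<Longrightarrow> U x = V x"
  shows "U x = V x"
proof -
  have "x \<in> {x. U x = V x}"
  proof (rule total_induct)
    show "subspace {x. U x = V x}"
      by (rule subspaceI) (auto simp: linear_simps[OF assms(1)] linear_simps[OF assms(2)])
    show "closed {x. U x = V x}"
      by (intro closed_Collect_eq linear_continuous_on assms)
  qed (use assms in auto)
  then show ?thesis by simp
qed

section \<open>Calculus of the spectral projections\<close>

lemma proj_Int: "proj (B \<inter> C) x = proj B (proj C x)"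
  by (rule bounded_linear_eqI[OF bounded_linear_proj
        bounded_linear_compose[OF bounded_linear_proj bounded_linear_proj]])
    (drule proj_eigenvector_all, simp)

lemma proj_Un:
  assumes "B \<inter> C = {}" shows "proj (B \<union> C) x = proj B x + proj C x"
  by (rule bounded_linear_eqI[OF bounded_linear_proj
        bounded_linear_add[OF bounded_linear_proj bounded_linear_proj]])
    (drule proj_eigenvector_all, use assms in auto)

lemma proj_empty: "proj {} x = 0"
  by (rule bounded_linear_eqI[OF bounded_linear_proj bounded_linear_zero])
    (drule proj_eigenvector_all, simp)

lemma proj_all:
  assumes "\<And>x l. T x = l *\<^sub>R x \<Longrightarrow> x \<noteq> 0 \<Longrightarrow> l \<in> B" shows "proj B x = x"
  by (rule bounded_linear_eqI[OF bounded_linear_proj bounded_linear_ident])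
    (use assms in \<open>frule_tac proj_eigenvector_all, auto\<close>)

text \<open>An operator commuting with \<open>T\<close> maps eigenvectors to eigenvectors with the
  same eigenvalue. It will be applied to multiplication by i and to restriction of the
  support.\<close>

lemma proj_commute:
  assumes "bounded_linear U" "\<And>x. U (T x) = T (U x)" shows "U (proj B x) = proj B (U x)"
proof (rule bounded_linear_eqI[OF bounded_linear_compose[OF assms(1) bounded_linear_proj]
      bounded_linear_compose[OF bounded_linear_proj assms(1)]])
  fix x l assume x: "T x = l *\<^sub>R x"
  then have "T (U x) = l *\<^sub>R U x"
    by (simp flip: assms(2) add: linear_simps[OF assms(1)])
  then show "U (proj B x) = proj B (U x)"
    by (simp add: proj_eigenvector[OF x] proj_eigenvector[OF \<open>T (U x) = _\<close>] linear_simps[OF assms(1)])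
qed

lemma T_proj_singleton: "T (proj {l} x) = l *\<^sub>R proj {l} x"
  by (rule bounded_linear_eqI[OF bounded_linear_compose[OF bounded_linear_T bounded_linear_proj]
        bounded_linear_const_scaleR[OF bounded_linear_proj]])
    (frule proj_eigenvector_all, simp add: linear_simps[OF bounded_linear_T])

lemma proj_sym: "proj B x \<bullet> y = x \<bullet> proj B y"
proof -
  have "(x - proj B x) \<bullet> proj B y = 0" "(y - proj B y) \<bullet> proj B x = 0"
    by (auto intro: proj_orth proj_in)
  then show ?thesis
    using inner_commute[of "proj B x" y] inner_commute[of "proj B x" "proj B y"]
    by (simp add: inner_diff_left)
qed

lemma proj_idem: "proj B (proj B x) = proj B x"
  using proj_Int[of B B x] by simp

lemma proj_inner_self: "proj B x \<bullet> x = (norm (proj B x))\<^sup>2"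
  by (metis power2_norm_eq_inner proj_idem proj_sym)

text \<open>Strong continuity from above, the source of countable additivity. On an eigenvector the
  projections are eventually 0, and the uniform bound \<open>norm_proj_le\<close> carries
  convergence over to limits of vectors.\<close>

lemma proj_decseq_tendsto_0:
  fixes G :: "nat \<Rightarrow> real set"
  assumes "decseq G" "(\<Inter>N. G N) = {}" shows "(\<lambda>N. proj (G N) x) \<longlonglongrightarrow> 0"
proof -
  let ?S = "{x. (\<lambda>N. proj (G N) x) \<longlonglongrightarrow> 0}"
  have "x \<in> ?S"
  proof (rule total_induct)
    show "subspace ?S"
    proof (rule subspaceI)
      show "c *\<^sub>R x \<in> ?S" if "x \<in> ?S" for c x
        using that by (auto intro: tendsto_eq_intros)
    qed (auto intro: tendsto_eq_intros)
    show "closed ?S"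
    proof (unfold closed_sequential_limits, intro allI impI)
      fix X x assume X: "(\<forall>n. X n \<in> ?S) \<and> X \<longlonglongrightarrow> x"
      have "(\<lambda>N. proj (G N) x) \<longlonglongrightarrow> 0"
      proof (rule LIMSEQ_I)
        fix e :: real assume "e > 0"
        then obtain n where n: "norm (X n - x) < e/2"
          using X LIMSEQ_D[of X x "e/2"] by auto
        from X have "(\<lambda>N. proj (G N) (X n)) \<longlonglongrightarrow> 0" by auto
        then obtain M where M: "\<And>N. N \<ge> M \<Longrightarrow> norm (proj (G N) (X n)) < e/2"
          using LIMSEQ_D[of "\<lambda>N. proj (G N) (X n)" 0 "e/2"] \<open>e > 0\<close> by auto
        have "norm (proj (G N) x) < e" if "N \<ge> M" for N
        proof -
          have "norm (proj (G N) x) \<le> norm (proj (G N) (X n)) + norm (proj (G N) (X n - x))"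
            using norm_triangle_ineq4[of "proj (G N) (X n)" "proj (G N) (X n - x)"] by simp
          with M[OF that] n norm_proj_le[of "G N" "X n - x"] show ?thesis by linarith
        qed
        then show "\<exists>no. \<forall>N\<ge>no. norm (proj (G N) x - 0) < e" by auto
      qed
      then show "x \<in> ?S" by simp
    qed
  next
    fix x l assume x: "T x = l *\<^sub>R x"
    from assms(2) obtain M where "l \<notin> G M" by auto
    then have "l \<notin> G N" if "N \<ge> M" for N using that assms(1) by (auto simp: decseq_def)
    then have "\<forall>\<^sub>F N in sequentially. proj (G N) x = 0"
      by (auto simp: eventually_sequentially proj_eigenvector[OF x])
    then show "x \<in> ?S" by (simp add: tendsto_eventually)
  qed
  then show ?thesis by simp
qed

lemma proj_finite_Union:
  assumes "disjoint_family F" shows "(\<Sum>i<(N::nat). proj (F i) x) = proj (\<Union>i<N. F i) x"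
proof (induction N)
  case 0
  then show ?case by (simp add: proj_empty)
next
  case (Suc N)
  have "F i \<inter> F N = {}" if "i < N" for i
    using assms that by (simp add: disjoint_family_on_def)
  then have "(\<Union>i<N. F i) \<inter> F N = {}" by auto
  from proj_Un[OF this, of x] Suc show ?case by (simp add: lessThan_Suc Un_commute)
qed

lemma proj_countably_additive:
  assumes "disjoint_family F"
  shows "(\<lambda>N. proj (\<Union>i. F i) x - (\<Sum>i<N. proj (F i) x)) \<longlonglongrightarrow> 0"
proof -
  let ?G = "\<lambda>N::nat. (\<Union>i. F i) - (\<Union>i<N. F i)"
  have "proj (\<Union>i. F i) x - (\<Sum>i<N. proj (F i) x) = proj (?G N) x" for N
  proof -
    have "proj (?G N \<union> (\<Union>i<N. F i)) x = proj (?G N) x + proj (\<Union>i<N. F i) x"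
      by (rule proj_Un) auto
    moreover have "?G N \<union> (\<Union>i<N. F i) = (\<Union>i. F i)" by auto
    ultimately show ?thesis using proj_finite_Union[OF assms] by simp
  qed
  moreover have "(\<lambda>N. proj (?G N) x) \<longlonglongrightarrow> 0"
    by (rule proj_decseq_tendsto_0) (auto simp: decseq_def)
  ultimately show ?thesis by simp
qed

text \<open>A vector is a limit of finite combinations of eigenvectors, so it meets only countably
  many eigenvalues. This allows the spectral integral to be computed from finite sums.\<close>

lemma proj_countable_support: "\<exists>C. countable C \<and> proj C x = x"
proof -
  have mono: "proj D x = x" if "proj C x = x" "C \<subseteq> D" for C D x
    using that proj_Int[of D C x] by (simp add: Int_absorb1)
  let ?S = "{x. \<exists>C. countable C \<and> proj C x = x}"
  have "x \<in> ?S"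
  proof (rule total_induct)
    show "subspace ?S"
    proof (rule subspaceI)
      show "0 \<in> ?S" by (auto intro: exI[of _ "{}"])
    next
      fix x y assume "x \<in> ?S" "y \<in> ?S"
      then obtain C D where "countable C" "proj C x = x" "countable D" "proj D y = y" by auto
      then show "x + y \<in> ?S"
        using mono[of C x "C \<union> D"] mono[of D y "C \<union> D"] by (auto intro!: exI[of _ "C \<union> D"])
    next
      fix c x assume "x \<in> ?S"
      then show "c *\<^sub>R x \<in> ?S" by auto
    qed
    show "closed ?S"
    proof (unfold closed_sequential_limits, intro allI impI)
      fix X x assume "(\<forall>n. X n \<in> ?S) \<and> X \<longlonglongrightarrow> x"
      then have X: "X \<longlonglongrightarrow> x" and "\<forall>n. \<exists>C. countable C \<and> proj C (X n) = X n" by auto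
      then obtain C where C: "\<And>n. countable (C n)" "\<And>n. proj (C n) (X n) = X n" by metis
      have "proj (\<Union>n. C n) (X n) = X n" for n by (rule mono[OF C(2)]) auto
      then have "X \<longlonglongrightarrow> proj (\<Union>n. C n) x"
        using bounded_linear.tendsto[OF bounded_linear_proj X, of "\<Union>n. C n"] by simp
      with X have "proj (\<Union>n. C n) x = x" by (metis LIMSEQ_unique)
      with C show "x \<in> ?S" by (auto intro!: exI[of _ "\<Union>n. C n"])
    qed
  next
    fix x l assume "T x = l *\<^sub>R x"
    then show "x \<in> ?S" by (auto dest: proj_eigenvector[where B = "{l}"] intro!: exI[of _ "{l}"])
  qed
  then show ?thesis by simp
qed

text \<open>The measure sits on a countable set \<open>C\<close> of eigenvalues. On a finite part
  \<open>F N\<close> both sides are the sum of l times the mass of l; the left side passes to the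
  limit by continuity of \<open>T\<close>, the right side by dominated convergence.\<close>

lemma inner_eq_spectral_integral:
  fixes \<mu> :: "real measure"
  assumes sets: "sets \<mu> = sets borel_unit"
    and em: "\<And>B. B \<in> sets borel_unit \<Longrightarrow> emeasure \<mu> B = ennreal ((norm (proj B x))\<^sup>2)"
    and id: "proj {-1..1} x = x"
  shows "T x \<bullet> x = (\<integral>t. t \<partial>\<mu>)"
proof -
  have sp: "space \<mu> = {-1..1}" using sets_eq_imp_space_eq[OF sets] by (simp add: space_restrict_space)
  have S: "B \<in> sets \<mu> \<longleftrightarrow> B \<in> sets borel \<and> B \<subseteq> {-1..1}" for B
    unfolding sets by (auto simp: sets_restrict_space_iff)
  obtain C0 where C0: "countable C0" "proj C0 x = x" using proj_countable_support by blast
  \<comment> \<open>Adding 0 makes the set nonempty, so that \<open>from_nat_into\<close> enumerates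
    it; enlarging it does not change the projection of \<open>x\<close>.\<close>
  define C where "C = insert 0 (C0 \<inter> {-1..1})"
  have C: "countable C" "0 \<in> C" "C \<subseteq> {-1..1}" using C0 by (auto simp: C_def)
  have "proj (C0 \<inter> {-1..1}) x = x" using C0 id by (simp add: proj_Int)
  then have Cx: "proj C x = x"
    using proj_Int[of C "C0 \<inter> {-1..1}" x] by (simp add: C_def Int_absorb1 subset_insertI)
  have meas: "D \<in> sets \<mu>" if "D \<subseteq> C" for D
    using that C countable_subset[OF that] by (auto simp: S intro: sets.countable)
  interpret finite_measure \<mu>
    by (rule finite_measureI) (simp add: sp em S sets[symmetric])
  have mu: "measure \<mu> B = (norm (proj B x))\<^sup>2" if "B \<in> sets \<mu>" for B
    using em that by (simp add: measure_def sets)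
  define F where "F N = from_nat_into C ` {..<N}" for N
  have FC: "F N \<subseteq> C" "finite (F N)" for N
    using from_nat_into[of C] C(2) by (fastforce simp: F_def)+
  have UF: "(\<Union>N. F N) = C"
  proof -
    have "(\<Union>N. F N) = range (from_nat_into C)" by (auto simp: F_def)
    moreover have "C \<noteq> {}" using C(2) by auto
    ultimately show ?thesis using range_from_nat_into[OF _ C(1)] by simp
  qed
  have lim1: "(\<lambda>N. proj (F N) x) \<longlonglongrightarrow> x"
  proof -
    have "(\<lambda>N. proj (C - F N) x) \<longlonglongrightarrow> 0"
      by (rule proj_decseq_tendsto_0) (use UF in \<open>auto simp: decseq_def F_def\<close>)
    moreover have "proj (F N) x = x - proj (C - F N) x" for N
      using proj_Un[of "F N" "C - F N" x] FC(1)[of N] Cx by (simp add: Un_absorb1 eq_diff_eq)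
    ultimately show ?thesis using tendsto_diff[OF tendsto_const, of "\<lambda>N. proj (C - F N) x" 0 sequentially x]
      by simp
  qed
  have projF: "proj A x = (\<Sum>l\<in>A. proj {l} x)" if "finite A" for A
    using that
  proof induction
    case empty then show ?case by (simp add: proj_empty)
  next
    case (insert a A)
    then show ?case using proj_Un[of "{a}" A x] by simp
  qed
  have "(\<lambda>N. T (proj (F N) x) \<bullet> x) \<longlonglongrightarrow> T x \<bullet> x"
    by (intro tendsto_intros bounded_linear.tendsto[OF bounded_linear_T] lim1)
  moreover have "T (proj (F N) x) \<bullet> x = (\<integral>t. indicator (F N) t * t \<partial>\<mu>)" for N
  proof -
    have "T (proj (F N) x) \<bullet> x = (\<Sum>l\<in>F N. l * measure \<mu> {l})"
      using FC by (simp add: projF[OF FC(2)] linear_sum[OF bounded_linear.linear[OF bounded_linear_T]]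
          T_proj_singleton inner_sum_left proj_inner_self mu meas subset_iff)
    also have "\<dots> = (\<integral>t. (\<Sum>l\<in>F N. l * indicator {l} t) \<partial>\<mu>)"
      by (subst Bochner_Integration.integral_sum)
        (use FC in \<open>auto simp: meas subset_iff intro!: integrable_mult_right integrable_real_indicator emeasure_finite
           simp: less_top[symmetric]\<close>)
    also have "(\<lambda>t. \<Sum>l\<in>F N. l * indicator {l} t) = (\<lambda>t. indicator (F N) t * t :: real)"
      using FC(2)[of N] by (auto simp: indicator_def if_distrib cong: if_cong)
    finally show ?thesis .
  qed
  ultimately have lim2: "(\<lambda>N. \<integral>t. indicator (F N) t * t \<partial>\<mu>) \<longlonglongrightarrow> T x \<bullet> x" by simp
  have id_meas: "(\<lambda>t. t) \<in> borel_measurable \<mu>"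
    unfolding measurable_cong_sets[OF sets refl] by (intro measurable_restrict_space1) simp
  have "(\<lambda>N. \<integral>t. indicator (F N) t * t \<partial>\<mu>) \<longlonglongrightarrow> (\<integral>t. indicator C t * t \<partial>\<mu>)"
  proof (rule integral_dominated_convergence[where w = "\<lambda>_. 1"])
    show "(\<lambda>t. indicator C t * t) \<in> borel_measurable \<mu>"
      using meas[of C] id_meas by (intro borel_measurable_times borel_measurable_indicator) auto
    show "(\<lambda>t. indicator (F N) t * t) \<in> borel_measurable \<mu>" for N
      using meas[OF FC(1)] id_meas by (intro borel_measurable_times borel_measurable_indicator) auto
    show "AE t in \<mu>. norm (indicator (F N) t * t) \<le> 1" for N
      by (auto simp: sp indicator_def abs_le_iff)
    show "AE t in \<mu>. (\<lambda>N. indicator (F N) t * t) \<longlonglongrightarrow> indicator C t * t"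
    proof (rule AE_I2)
      fix t
      have "incseq F" by (auto simp: incseq_def F_def)
      from LIMSEQ_indicator_incseq[OF this, of t]
      show "(\<lambda>N. indicator (F N) t * t) \<longlonglongrightarrow> indicator C t * t"
        by (intro tendsto_intros) (simp add: UF)
    qed
  qed simp
  with lim2 have "T x \<bullet> x = (\<integral>t. indicator C t * t \<partial>\<mu>)" by (rule LIMSEQ_unique)
  also have "\<dots> = (\<integral>t. t \<partial>\<mu>)"
  proof (rule integral_cong_AE)
    have D: "{-1..1} - C \<in> sets \<mu>" using sets.compl_sets[OF meas[of C]] by (simp add: sp)
    have "proj ({-1..1} - C) x = proj (({-1..1} - C) \<inter> C) x" using Cx proj_Int by metis
    then have "emeasure \<mu> ({-1..1} - C) = 0"
      using D by (simp add: em sets[symmetric] Diff_Int_distrib2 proj_empty Diff_disjoint Int_commute)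
    then have "{-1..1} - C \<in> null_sets \<mu>" using D by (rule null_setsI)
    then have "AE t in \<mu>. t \<notin> {-1..1} - C" by (rule AE_not_in)
    moreover have "AE t in \<mu>. t \<in> {-1..1}" using sp by (intro AE_I2) simp
    ultimately show "AE t in \<mu>. indicator C t * t = t" by eventually_elim (auto simp: indicator_def)
    show "(\<lambda>t. indicator C t * t) \<in> borel_measurable \<mu>"
      using meas[of C] id_meas by (intro borel_measurable_times borel_measurable_indicator) auto
  qed (rule id_meas)
  finally show ?thesis .
qed

end

section \<open>Spectral resolutions of operators with pure point spectrum\<close>

lift_definition ell2_i :: "'a ell2 \<Rightarrow> 'a ell2" is "\<lambda>f x. \<i> * f x"
  by (simp add: norm_mult)

lift_definition ell2_restrict :: "'a set \<Rightarrow> 'a ell2 \<Rightarrow> 'a ell2" is "\<lambda>A f x. if x \<in> A then f x else 0"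
  by (rule summable_on_comparison_test) auto

lemma norm_ell2_le_of_cmod_le:
  assumes "\<And>x. cmod (ell2_fun f x) \<le> cmod (ell2_fun g x)" shows "norm f \<le> norm g"
proof (rule power2_le_imp_le)
  show "(norm f)\<^sup>2 \<le> (norm g)\<^sup>2"
    by (rule has_sum_mono[OF ell2_norm_has_sum ell2_norm_has_sum]) (auto intro: power_mono assms)
qed simp

lemma bounded_linear_ell2_i: "bounded_linear ell2_i"
proof (rule bounded_linear_intro[where K = 1])
  show "ell2_i (x + y) = ell2_i x + ell2_i y" "ell2_i (r *\<^sub>R x) = r *\<^sub>R ell2_i x" for x y :: "'a ell2" and r
    by (transfer; simp add: algebra_simps)+
  show "norm (ell2_i x) \<le> norm x * 1" for x :: "'a ell2"
    by (simp, rule norm_ell2_le_of_cmod_le) (simp add: ell2_i.rep_eq norm_mult)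
qed

lemma bounded_linear_ell2_restrict: "bounded_linear (ell2_restrict A)"
proof (rule bounded_linear_intro[where K = 1])
  show "ell2_restrict A (x + y) = ell2_restrict A x + ell2_restrict A y"
    "ell2_restrict A (r *\<^sub>R x) = r *\<^sub>R ell2_restrict A x" for x y :: "'a ell2" and r
    by (transfer; auto)+
  show "norm (ell2_restrict A x) \<le> norm x * 1" for x :: "'a ell2"
    by (simp, rule norm_ell2_le_of_cmod_le) (simp add: ell2_restrict.rep_eq)
qed

definition ell2_supported :: "'a set \<Rightarrow> 'a ell2 \<Rightarrow> bool"
  where "ell2_supported A f \<longleftrightarrow> (\<forall>x. x \<notin> A \<longrightarrow> ell2_fun f x = 0)"

lemma ell2_supported_iff_restrict: "ell2_supported A f \<longleftrightarrow> ell2_restrict A f = f"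
  by (auto simp: ell2_supported_def ell2_fun_inject[symmetric] ell2_restrict.rep_eq fun_eq_iff)

lemma ell2_supported_simps [simp]:
  "ell2_supported A 0"
  "ell2_supported A f \<Longrightarrow> ell2_supported A g \<Longrightarrow> ell2_supported A (f + g)"
  "ell2_supported A f \<Longrightarrow> ell2_supported A g \<Longrightarrow> ell2_supported A (f - g)"
  "ell2_supported A f \<Longrightarrow> ell2_supported A (ell2_i f)"
  "ell2_supported A f \<Longrightarrow> ell2_supported A (r *\<^sub>R f)"
  by (auto simp: ell2_supported_def zero_ell2.rep_eq plus_ell2.rep_eq minus_ell2.rep_eq
      ell2_i.rep_eq scaleR_ell2.rep_eq)

lemma ell2_supported_sum [simp]:
  "(\<And>i. i \<in> I \<Longrightarrow> ell2_supported A (f i)) \<Longrightarrow> ell2_supported A (\<Sum>i\<in>I. f i)"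
  by (simp add: ell2_supported_def ell2_fun_sum)

lemma ell2_fun_in_l2 [simp]: "ell2_fun f \<in> l2 A \<longleftrightarrow> ell2_supported A f"
  using ell2_fun[of f] unfolding l2_def ell2_supported_def
  by (auto intro: summable_on_subset)

lemma l2_cases:
  assumes "f \<in> l2 A" obtains F where "f = ell2_fun F" "ell2_supported A F"
proof -
  have "(\<lambda>x. (cmod (f x))\<^sup>2) summable_on A" and 0: "\<And>x. x \<notin> A \<Longrightarrow> f x = 0"
    using assms by (auto simp: l2_def)
  then have "(\<lambda>x. (cmod (f x))\<^sup>2) summable_on UNIV"
    by (subst summable_on_cong_neutral[where T = A and g = "\<lambda>x. (cmod (f x))\<^sup>2"]) auto
  then have "f = ell2_fun (Abs_ell2 f)" by (simp add: Abs_ell2_inverse)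
  moreover from this have "ell2_supported A (Abs_ell2 f)" using 0 by (simp add: ell2_supported_def)
  ultimately show ?thesis by (rule that)
qed

lemma l2_norm_ell2_fun:
  assumes "ell2_supported A f" shows "l2_norm A (ell2_fun f) = norm f"
proof -
  have "(\<Sum>\<^sub>\<infinity>x\<in>A. (cmod (ell2_fun f x))\<^sup>2) = (\<Sum>\<^sub>\<infinity>x. (cmod (ell2_fun f x))\<^sup>2)"
    by (rule infsum_cong_neutral) (use assms in \<open>auto simp: ell2_supported_def\<close>)
  also have "\<dots> = (norm f)\<^sup>2" by (rule infsumI[OF ell2_norm_has_sum])
  finally show ?thesis by (simp add: l2_norm_def)
qed

text \<open>The imaginary part of z times the conjugate of w is the real inner product of z with i
  w, so the real structure together with \<open>ell2_i\<close> determines the complex inner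
  product.\<close>

lemma l2_inner_ell2_fun:
  assumes "ell2_supported A f"
  shows "l2_inner A (ell2_fun f) (ell2_fun g) = Complex (f \<bullet> g) (f \<bullet> ell2_i g)"
proof -
  have "((\<lambda>x. complex_of_real (ell2_fun f x \<bullet> ell2_fun g x) + \<i> * complex_of_real (ell2_fun f x \<bullet> ell2_fun (ell2_i g) x))
      has_sum complex_of_real (f \<bullet> g) + \<i> * complex_of_real (f \<bullet> ell2_i g)) UNIV"
    by (intro has_sum_add has_sum_cmult_right has_sum_of_real ell2_inner_has_sum)
  also have "(\<lambda>x. complex_of_real (ell2_fun f x \<bullet> ell2_fun g x) + \<i> * complex_of_real (ell2_fun f x \<bullet> ell2_fun (ell2_i g) x))
      = (\<lambda>x. ell2_fun f x * cnj (ell2_fun g x))"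
    by (auto simp: fun_eq_iff complex_eq_iff inner_complex_def ell2_i.rep_eq algebra_simps)
  finally have "(\<Sum>\<^sub>\<infinity>x. ell2_fun f x * cnj (ell2_fun g x)) = Complex (f \<bullet> g) (f \<bullet> ell2_i g)"
    by (simp add: infsumI Complex_eq)
  moreover have "(\<Sum>\<^sub>\<infinity>x\<in>A. ell2_fun f x * cnj (ell2_fun g x)) = (\<Sum>\<^sub>\<infinity>x. ell2_fun f x * cnj (ell2_fun g x))"
    by (rule infsum_cong_neutral) (use assms in \<open>auto simp: ell2_supported_def\<close>)
  ultimately show ?thesis by (simp add: l2_inner_def)
qed

lemma ell2_fun_add: "(\<lambda>x. ell2_fun f x + ell2_fun g x) = ell2_fun (f + g)"
  by (simp add: plus_ell2.rep_eq)

lemma ell2_fun_scale_complex: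
  "(\<lambda>x. c * ell2_fun f x) = ell2_fun (Re c *\<^sub>R f + Im c *\<^sub>R ell2_i f)"
  by (auto simp: fun_eq_iff plus_ell2.rep_eq scaleR_ell2.rep_eq ell2_i.rep_eq complex_eq_iff)

lemma ell2_fun_diff_sum:
  "(\<lambda>x. ell2_fun f x - (\<Sum>i\<in>I. ell2_fun (g i) x)) = ell2_fun (f - (\<Sum>i\<in>I. g i))"
  by (simp add: minus_ell2.rep_eq ell2_fun_sum)

lemma ell2_i_inner: "ell2_i f \<bullet> g = - (f \<bullet> ell2_i g)"
proof -
  have "((\<lambda>x. - (ell2_fun f x \<bullet> ell2_fun (ell2_i g) x)) has_sum - (f \<bullet> ell2_i g)) UNIV"
    by (intro has_sum_uminusI ell2_inner_has_sum)
  also have "(\<lambda>x. - (ell2_fun f x \<bullet> ell2_fun (ell2_i g) x)) = (\<lambda>x. ell2_fun (ell2_i f) x \<bullet> ell2_fun g x)"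
    by (auto simp: fun_eq_iff inner_complex_def ell2_i.rep_eq algebra_simps)
  finally show ?thesis using ell2_inner_has_sum by (rule has_sum_unique[rotated])
qed

subsection \<open>The scalar measures of a projection-valued measure\<close>

text \<open>Concerns an arbitrary projection-valued measure, so that it covers both the resolution
  constructed below and the one picked by choice.\<close>

locale ell2_pvm =
  fixes A :: "'a set" and X :: "'x measure" and E :: "'x set \<Rightarrow> ('a \<Rightarrow> complex) \<Rightarrow> ('a \<Rightarrow> complex)"
  assumes pvm: "projection_valued_measure A X E"
begin

text \<open>Transports \<open>E B\<close> to the type \<open>ell2\<close>. The axioms say nothing
  about vectors outside \<open>l2 A\<close> or sets outside \<open>X\<close>, so \<open>e\<close> is
  controlled only for supported vectors and measurable sets.\<close>

definition e :: "'x set \<Rightarrow> 'a ell2 \<Rightarrow> 'a ell2"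
  where "e B f = Abs_ell2 (E B (ell2_fun f))"

lemma oproj: "B \<in> sets X \<Longrightarrow> orthogonal_projection A (E B)"
  using pvm by (simp add: projection_valued_measure_def)

lemma e_props:
  assumes "B \<in> sets X" "ell2_supported A f"
  shows ell2_fun_e: "ell2_fun (e B f) = E B (ell2_fun f)"
    and e_supported: "ell2_supported A (e B f)"
proof -
  have "E B (ell2_fun f) \<in> l2 A"
    using oproj[OF assms(1)] assms(2) by (simp add: orthogonal_projection_def)
  then obtain F where "E B (ell2_fun f) = ell2_fun F" "ell2_supported A F" by (rule l2_cases)
  then show "ell2_fun (e B f) = E B (ell2_fun f)" "ell2_supported A (e B f)"
    by (simp_all add: e_def ell2_fun_inverse)
qed

lemma e_idem: "B \<in> sets X \<Longrightarrow> ell2_supported A f \<Longrightarrow> e B (e B f) = e B f"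
  using oproj[of B] by (simp add: orthogonal_projection_def e_def[of B "e B f"] ell2_fun_e)
    (simp add: e_def)

lemma e_sym:
  assumes "B \<in> sets X" "ell2_supported A f" "ell2_supported A g"
  shows "e B f \<bullet> g = f \<bullet> e B g"
proof -
  have "l2_inner A (E B (ell2_fun f)) (ell2_fun g) = l2_inner A (ell2_fun f) (E B (ell2_fun g))"
    using oproj[OF assms(1)] assms(2,3) by (simp add: orthogonal_projection_def)
  then show ?thesis
    using assms by (simp flip: ell2_fun_e add: l2_inner_ell2_fun e_supported)
qed

lemma e_empty: "ell2_supported A f \<Longrightarrow> e {} f = 0"
  using pvm by (simp add: projection_valued_measure_def e_def zero_ell2_def)

lemma e_space: "ell2_supported A f \<Longrightarrow> e (space X) f = f"
  using pvm by (simp add: projection_valued_measure_def e_def ell2_fun_inverse)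

lemma e_Int:
  "B \<in> sets X \<Longrightarrow> C \<in> sets X \<Longrightarrow> ell2_supported A f \<Longrightarrow> e (B \<inter> C) f = e B (e C f)"
  using pvm by (simp add: projection_valued_measure_def e_def[of B "e C f"] ell2_fun_e)
    (simp add: e_def)

lemma e_inner_self:
  assumes "B \<in> sets X" "ell2_supported A f" shows "e B f \<bullet> f = (norm (e B f))\<^sup>2"
  using assms by (metis e_idem e_supported e_sym power2_norm_eq_inner)

lemma e_countably_additive:
  assumes "range F \<subseteq> sets X" "disjoint_family F" "ell2_supported A f"
  shows "(\<lambda>i. e (F i) f) sums e (\<Union>i. F i) f"
proof -
  have S: "F i \<in> sets X" "(\<Union>i. F i) \<in> sets X" for i using assms by auto
  have "(\<lambda>N. l2_norm A (\<lambda>x. E (\<Union>i. F i) (ell2_fun f) x - (\<Sum>i<N. E (F i) (ell2_fun f) x))) \<longlonglongrightarrow> 0"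
    using pvm assms by (simp add: projection_valued_measure_def)
  moreover have "l2_norm A (\<lambda>x. E (\<Union>i. F i) (ell2_fun f) x - (\<Sum>i<N. E (F i) (ell2_fun f) x)) =
      norm (e (\<Union>i. F i) f - (\<Sum>i<N. e (F i) f))" for N
    using S assms(3) by (simp flip: ell2_fun_e add: ell2_fun_diff_sum l2_norm_ell2_fun e_supported)
  ultimately have "(\<lambda>N. e (\<Union>i. F i) f - (\<Sum>i<N. e (F i) f)) \<longlonglongrightarrow> 0"
    by (simp add: tendsto_norm_zero_iff)
  from tendsto_diff[OF tendsto_const this, of "e (\<Union>i. F i) f"] show ?thesis
    by (simp add: sums_def)
qed

lemma e_Un:
  assumes "B \<in> sets X" "C \<in> sets X" "B \<inter> C = {}" "ell2_supported A f"
  shows "e (B \<union> C) f = e B f + e C f"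
proof -
  have "(\<lambda>i. e (binaryset B C i) f) sums e (\<Union>i. binaryset B C i) f"
    using assms by (intro e_countably_additive disjoint_family_on_disjoint_image)
      (auto simp: range_binaryset_eq binaryset_def disjoint_family_on_def)
  moreover have "(\<lambda>i. e (binaryset B C i) f) sums (e B f + e C f)"
    using assms(4) by (intro binaryset_sums) (simp add: e_empty)
  ultimately show ?thesis by (simp add: UN_binaryset_eq sums_iff)
qed

lemma sets_scalar_measure [simp]: "sets (scalar_measure A X E f) = sets X"
  by (simp add: scalar_measure_def sets.sets_measure_of_eq)

text \<open>Self-adjointness and idempotence turn <E(B)f, f> into a squared norm, so
  \<open>ennreal\<close> loses nothing; strong countable additivity, paired with f, makes the set
  function a measure.\<close>

lemma emeasure_scalar_measure:
  assumes B: "B \<in> sets X" and f: "ell2_supported A f"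
  shows "emeasure (scalar_measure A X E (ell2_fun f)) B = ennreal ((norm (e B f))\<^sup>2)"
proof -
  have eq: "Re (l2_inner A (E B (ell2_fun f)) (ell2_fun f)) = (norm (e B f))\<^sup>2" if "B \<in> sets X" for B
    using that f by (simp flip: ell2_fun_e add: l2_inner_ell2_fun e_supported e_inner_self)
  have "countably_additive (sets X) (\<lambda>B. ennreal (Re (l2_inner A (E B (ell2_fun f)) (ell2_fun f))))"
  proof (rule countably_additiveI)
    fix F :: "nat \<Rightarrow> 'x set"
    assume F: "range F \<subseteq> sets X" "disjoint_family F" "(\<Union>i. F i) \<in> sets X"
    have "(\<lambda>i. e (F i) f \<bullet> f) sums (e (\<Union>i. F i) f \<bullet> f)"
      by (intro bounded_linear.sums[OF bounded_linear_inner_left] e_countably_additive F f)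
    then have "(\<lambda>i. (norm (e (F i) f))\<^sup>2) sums (norm (e (\<Union>i. F i) f))\<^sup>2"
      using F f by (simp add: e_inner_self subset_iff)
    then show "(\<Sum>i. ennreal (Re (l2_inner A (E (F i) (ell2_fun f)) (ell2_fun f)))) =
        ennreal (Re (l2_inner A (E (\<Union>i. F i) (ell2_fun f)) (ell2_fun f)))"
      using F by (simp add: eq subset_iff suminf_ennreal2 sums_iff)
  qed
  moreover have "positive (sets X) (\<lambda>B. ennreal (Re (l2_inner A (E B (ell2_fun f)) (ell2_fun f))))"
    by (simp add: positive_def eq e_empty f)
  ultimately show ?thesis
    using B unfolding scalar_measure_def
    by (subst emeasure_measure_of_sigma) (auto simp: eq sets.sigma_algebra_axioms)
qed

end

subsection \<open>Existence and values on eigenvectors\<close>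

text \<open>\<open>M\<close> acts on functions supported in \<open>A\<close>, while \<open>T\<close>
  acts on the whole space: it ignores values off \<open>A\<close> and produces none there. The
  contraction bound places all eigenvalues in [-1,1].\<close>

locale ell2_pure_point = pure_point_operator T for T :: "'a ell2 \<Rightarrow> 'a ell2" +
  fixes A :: "'a set" and M :: "('a \<Rightarrow> complex) \<Rightarrow> ('a \<Rightarrow> complex)"
  assumes T_i: "T (ell2_i x) = ell2_i (T x)"
    and T_supported: "ell2_supported A (T x)"
    and T_restrict: "T (ell2_restrict A x) = T x"
    and T_contraction: "norm (T x) \<le> norm x"
    and M_eq: "ell2_supported A x \<Longrightarrow> M (ell2_fun x) = ell2_fun (T x)"
begin

lemma eigenvalue_bounded:
  assumes "T x = l *\<^sub>R x" "x \<noteq> 0" shows "l \<in> {-1..1}"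
proof -
  have "\<bar>l\<bar> * norm x \<le> 1 * norm x" using T_contraction[of x] assms by simp
  then have "\<bar>l\<bar> \<le> 1" using assms(2) by (simp add: mult_le_cancel_right1)
  then show ?thesis by auto
qed

lemma proj_space: "proj {-1..1} x = x"
  using eigenvalue_bounded by (rule proj_all)

text \<open>By the two support axioms \<open>T\<close> commutes with \<open>ell2_restrict A\<close>,
  hence so do its spectral projections.\<close>

lemma proj_supported: "ell2_supported A x \<Longrightarrow> ell2_supported A (proj B x)"
  using proj_commute[OF bounded_linear_ell2_restrict, of A B x] T_supported T_restrict
  by (simp add: ell2_supported_iff_restrict)

lemma proj_i: "proj B (ell2_i x) = ell2_i (proj B x)"
  by (rule proj_commute[OF bounded_linear_ell2_i, symmetric]) (simp add: T_i)

definition resolution :: "real set \<Rightarrow> ('a \<Rightarrow> complex) \<Rightarrow> ('a \<Rightarrow> complex)"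
  where "resolution B f = ell2_fun (proj B (Abs_ell2 f))"

lemma resolution_ell2_fun [simp]: "resolution B (ell2_fun x) = ell2_fun (proj B x)"
  by (simp add: resolution_def ell2_fun_inverse)

lemma orthogonal_projection_resolution: "orthogonal_projection A (resolution B)"
  unfolding orthogonal_projection_def
proof (intro conjI ballI allI)
  fix f assume "f \<in> l2 A"
  then obtain F where F: "f = ell2_fun F" "ell2_supported A F" by (rule l2_cases)
  then show "resolution B f \<in> l2 A" by (simp add: proj_supported)
  show "resolution B (resolution B f) = resolution B f" by (simp add: F proj_idem)
  show "resolution B (\<lambda>x. c * f x) = (\<lambda>x. c * resolution B f x)" for c
    by (simp add: F ell2_fun_scale_complex proj_i)
  fix h assume "h \<in> l2 A"
  then obtain H where H: "h = ell2_fun H" "ell2_supported A H" by (rule l2_cases)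
  show "resolution B (\<lambda>x. f x + h x) = (\<lambda>x. resolution B f x + resolution B h x)"
    by (simp add: F H ell2_fun_add)
  show "l2_inner A (resolution B f) h = l2_inner A f (resolution B h)"
    using F H by (simp add: l2_inner_ell2_fun proj_supported proj_sym proj_i)
qed

lemma projection_valued_measure_resolution: "projection_valued_measure A borel_unit resolution"
  unfolding projection_valued_measure_def
proof (intro conjI ballI allI impI orthogonal_projection_resolution)
  fix f assume "f \<in> l2 A"
  then obtain F where F: "f = ell2_fun F" "ell2_supported A F" by (rule l2_cases)
  show "resolution {} f = (\<lambda>_. 0)" by (simp add: F proj_empty zero_ell2.rep_eq)
  show "resolution (space borel_unit) f = f"
    using proj_space by (simp add: F space_restrict_space)
  show "resolution (B \<inter> C) f = resolution B (resolution C f)" for B C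
    by (simp add: F proj_Int)
  fix D :: "nat \<Rightarrow> real set" assume "disjoint_family D"
  from tendsto_norm_zero[OF proj_countably_additive[OF this]]
  show "(\<lambda>N. l2_norm A (\<lambda>x. resolution (\<Union>i. D i) f x - (\<Sum>i<N. resolution (D i) f x))) \<longlonglongrightarrow> 0"
    using F by (simp add: ell2_fun_diff_sum l2_norm_ell2_fun proj_supported)
qed

lemma spectral_resolution_resolution: "spectral_resolution A M resolution"
  unfolding spectral_resolution_def
proof (intro conjI ballI projection_valued_measure_resolution)
  interpret ell2_pvm A borel_unit resolution
    by unfold_locales (rule projection_valued_measure_resolution)
  fix f assume "f \<in> l2 A"
  then obtain F where F: "f = ell2_fun F" "ell2_supported A F" by (rule l2_cases)
  have "T F \<bullet> F = (\<integral>t. t \<partial>(scalar_measure A borel_unit resolution f))"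
  proof (rule inner_eq_spectral_integral)
    fix B assume "B \<in> sets borel_unit"
    then show "emeasure (scalar_measure A borel_unit resolution f) B = ennreal ((norm (proj B F))\<^sup>2)"
      using F emeasure_scalar_measure[of B F] by (simp add: e_def ell2_fun_inverse)
  qed (auto simp: proj_space)
  \<comment> \<open>The imaginary part of <T F, F> vanishes: \<open>T\<close> is symmetric and
    commutes with \<open>ell2_i\<close>, which is antisymmetric.\<close>
  moreover have "T F \<bullet> ell2_i F = 0"
    using ell2_i_inner[of F "T F"] T_sym[of F "ell2_i F"] by (simp add: T_i inner_commute)
  ultimately show "l2_inner A (M f) f = complex_of_real (\<integral>t. t \<partial>(scalar_measure A borel_unit resolution f))"
    using F by (simp add: M_eq l2_inner_ell2_fun T_supported complex_of_real_def)
qed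

end

text \<open>Here \<open>E\<close> is any resolution of the operator, not the constructed one. The
  aim is that it must treat each eigenvector as the spectral projections do.\<close>

locale ell2_resolution = ell2_pure_point + ell2_pvm A borel_unit E for E +
  assumes resolution: "spectral_resolution A M E"
begin

lemma sets_unit: "B \<in> sets borel_unit \<longleftrightarrow> B \<in> sets borel \<and> B \<subseteq> {-1..1::real}"
  by (auto simp: sets_restrict_space_iff)

abbreviation \<mu> :: "'a ell2 \<Rightarrow> real measure"
  where "\<mu> x \<equiv> scalar_measure A borel_unit E (ell2_fun x)"

lemma space_\<mu>: "space (\<mu> x) = {-1..1}"
  using sets_eq_imp_space_eq[OF sets_scalar_measure, of "ell2_fun x"]
  by (simp add: space_restrict_space)

lemma id_measurable_\<mu>: "(\<lambda>t. t) \<in> borel_measurable (\<mu> x)"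
  unfolding measurable_cong_sets[OF sets_scalar_measure refl]
  by (intro measurable_restrict_space1) simp

lemma inner_eq_integral:
  assumes "ell2_supported A x" shows "T x \<bullet> x = (\<integral>t. t \<partial>\<mu> x)"
proof -
  have "l2_inner A (M (ell2_fun x)) (ell2_fun x) = complex_of_real (\<integral>t. t \<partial>\<mu> x)"
    using resolution assms by (simp add: spectral_resolution_def)
  then show ?thesis
    using assms by (simp add: M_eq l2_inner_ell2_fun T_supported complex_of_real_def)
qed

lemma finite_measure_\<mu>: "ell2_supported A x \<Longrightarrow> finite_measure (\<mu> x)"
  by (rule finite_measureI) (simp add: space_\<mu> emeasure_scalar_measure sets_unit)

text \<open>Multiplicativity of \<open>e\<close> says that the measure of \<open>e B x\<close> is
  the measure of \<open>x\<close> restricted to \<open>B\<close>.\<close>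

lemma integral_\<mu>_e:
  assumes x: "ell2_supported A x" and B: "B \<in> sets borel_unit"
  shows "(\<integral>t. t \<partial>\<mu> (e B x)) = (\<integral>t. indicator B t * t \<partial>\<mu> x)"
proof -
  have "\<mu> (e B x) = density (\<mu> x) (\<lambda>t. ennreal (indicator B t))"
  proof (rule measure_eqI)
    fix C assume "C \<in> sets (\<mu> (e B x))"
    then have C: "C \<in> sets borel_unit" by simp
    then have "emeasure (\<mu> (e B x)) C = emeasure (\<mu> x) (B \<inter> C)"
      using x B by (simp add: emeasure_scalar_measure e_supported Int_commute sets.Int e_Int[symmetric])
    also have "\<dots> = emeasure (density (\<mu> x) (\<lambda>t. ennreal (indicator B t))) C"
      using B C by (simp add: ennreal_indicator emeasure_restricted)
    finally show "emeasure (\<mu> (e B x)) C = emeasure (density (\<mu> x) (\<lambda>t. ennreal (indicator B t))) C" .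
  qed simp
  moreover have "(\<integral>t. t \<partial>density (\<mu> x) (\<lambda>t. ennreal (indicator B t))) = (\<integral>t. indicator B t *\<^sub>R t \<partial>\<mu> x)"
    using id_measurable_\<mu> B by (intro integral_density borel_measurable_indicator) auto
  ultimately show ?thesis by simp
qed

lemma e_compl:
  assumes "ell2_supported A x" "B \<in> sets borel_unit"
  shows "x = e B x + e ({-1..1} - B) x"
proof -
  have B': "{-1..1} - B \<in> sets borel_unit"
    using assms(2) by (auto simp: sets_unit)
  have "B \<union> ({-1..1} - B) = space borel_unit"
    using assms(2) by (auto simp: sets_unit space_restrict_space)
  then show ?thesis
    using e_Un[OF assms(2) B' _ assms(1)] e_space[OF assms(1)] by auto
qed

text \<open>The measures of \<open>e B x\<close> and of its complement add up to that of \<open>x\<close>, so the cross term in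
  \<open>\<langle>T x, x\<rangle>\<close> vanishes and \<open>T\<close> is compressed to the range of \<open>e B\<close>.\<close>

lemma inner_T_e:
  assumes x: "ell2_supported A x" and B: "B \<in> sets borel_unit"
  shows "T x \<bullet> e B x = (\<integral>t. indicator B t * t \<partial>\<mu> x)"
proof -
  let ?C = "{-1..1} - B"
  interpret finite_measure "\<mu> x" by (rule finite_measure_\<mu>) fact
  have C: "?C \<in> sets borel_unit" using B by (auto simp: sets_unit)
  let ?g = "e B x" and ?u = "e ?C x"
  have xgu: "x = ?g + ?u" by (rule e_compl) fact+
  have int: "integrable (\<mu> x) (\<lambda>t. indicator D t * t)" if "D \<in> sets borel_unit" for D
  proof (rule integrable_const_bound[where B = 1])
    show "AE t in \<mu> x. norm (indicator D t * t) \<le> 1"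
      by (auto simp: space_\<mu> indicator_def abs_le_iff)
    show "(\<lambda>t. indicator D t * t) \<in> borel_measurable (\<mu> x)"
      using id_measurable_\<mu> that by (intro borel_measurable_times borel_measurable_indicator) auto
  qed
  have "T x \<bullet> x = (\<integral>t. indicator B t * t + indicator ?C t * t \<partial>\<mu> x)"
    unfolding inner_eq_integral[OF x]
    by (rule Bochner_Integration.integral_cong) (auto simp: indicator_def space_\<mu>)
  also have "\<dots> = T ?g \<bullet> ?g + T ?u \<bullet> ?u"
    using x B C int by (simp add: inner_eq_integral e_supported integral_\<mu>_e)
  finally have "T (?g + ?u) \<bullet> (?g + ?u) = T ?g \<bullet> ?g + T ?u \<bullet> ?u"
    by (simp flip: xgu)
  then have "T ?u \<bullet> ?g = 0"
    using T_sym[of ?g ?u]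
    by (simp add: linear_simps[OF bounded_linear_T] inner_add_left inner_add_right inner_commute)
  then have "T x \<bullet> ?g = T ?g \<bullet> ?g"
    by (subst xgu) (simp add: linear_simps[OF bounded_linear_T] inner_add_left)
  also have "\<dots> = (\<integral>t. indicator B t * t \<partial>\<mu> x)"
    using x B by (simp add: inner_eq_integral e_supported integral_\<mu>_e)
  finally show ?thesis .
qed

text \<open>\<open>s\<close> is a sign, and \<open>B\<close> lies strictly on one side of the
  eigenvalue. By \<open>inner_T_e\<close> and the eigenvalue equation the integral of s (t - l) over
  \<open>B\<close> is 0; its integrand is positive on \<open>B\<close>, so \<open>B\<close> is null
  for the measure of \<open>x\<close>.\<close>

lemma e_eigenvector_one_side:
  fixes s :: real
  assumes x: "ell2_supported A x" "T x = l *\<^sub>R x"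
    and B: "B \<in> sets borel_unit" "\<And>t. t \<in> B \<Longrightarrow> s * (t - l) > 0"
  shows "e B x = 0"
proof -
  interpret finite_measure "\<mu> x" by (rule finite_measure_\<mu>) fact
  have [measurable]: "B \<in> sets (\<mu> x)" using B by simp
  note [measurable] = id_measurable_\<mu>[of x]
  have int: "integrable (\<mu> x) (\<lambda>t. indicator B t * t)"
    by (rule integrable_const_bound[where B = 1])
      (auto simp: space_\<mu> indicator_def abs_le_iff intro!: AE_I2)
  have intB: "integrable (\<mu> x) (\<lambda>t. indicator B t :: real)"
    by (rule integrable_const_bound[where B = 1]) (auto simp: indicator_def)
  have "(\<integral>t. indicator B t * (s * (t - l)) \<partial>\<mu> x) = s * ((\<integral>t. indicator B t * t \<partial>\<mu> x) - l * measure (\<mu> x) B)"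
  proof -
    have "(\<lambda>t. indicator B t * (s * (t - l))) = (\<lambda>t. s * (indicator B t * t - l * indicator B t))"
      by (auto simp: fun_eq_iff algebra_simps)
    then show ?thesis using int intB B(1) by (simp add: sets.Int_space_eq2)
  qed
  also have "(\<integral>t. indicator B t * t \<partial>\<mu> x) = l * measure (\<mu> x) B"
    using inner_T_e[OF x(1) B(1)] x e_inner_self[OF B(1) x(1)] emeasure_scalar_measure[OF B(1) x(1)]
    by (simp add: inner_commute measure_def)
  finally have "(\<integral>t. indicator B t * (s * (t - l)) \<partial>\<mu> x) = 0" by simp
  moreover have "integrable (\<mu> x) (\<lambda>t. indicator B t * (s * (t - l)))"
  proof -
    have "(\<lambda>t. indicator B t * (s * (t - l))) = (\<lambda>t. s * (indicator B t * t - l * indicator B t))"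
      by (auto simp: fun_eq_iff algebra_simps)
    then show ?thesis using int intB by simp
  qed
  moreover have "indicator B t * (s * (t - l)) \<ge> 0" for t
    using B(2)[of t] by (auto simp: indicator_def)
  ultimately have "AE t in \<mu> x. indicator B t * (s * (t - l)) = 0"
    by (subst (asm) integral_nonneg_eq_0_iff_AE) auto
  then have "AE t in \<mu> x. t \<notin> B"
    by eventually_elim (use B(2) in \<open>force simp: indicator_def split: if_splits\<close>)
  moreover have "{t \<in> space (\<mu> x). \<not> t \<notin> B} = B"
    using B(1) by (auto simp: space_\<mu> sets_unit)
  ultimately have "emeasure (\<mu> x) B = 0"
    using AE_iff_measurable[of B "\<mu> x" "\<lambda>t. t \<notin> B"] B(1) by simp
  then show ?thesis
    using emeasure_scalar_measure[OF B(1) x(1)] by simp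
qed

text \<open>A set missing \<open>l\<close> splits into the parts to the right and to the left of
  \<open>l\<close>, each killing \<open>x\<close>. If \<open>l\<close> is in \<open>B\<close>, this
  applies to the complement of \<open>B\<close>.\<close>

lemma e_eigenvector:
  assumes x: "ell2_supported A x" "T x = l *\<^sub>R x" and B: "B \<in> sets borel_unit"
  shows "e B x = (if l \<in> B then x else 0)"
proof -
  have off: "e C x = 0" if C: "C \<in> sets borel_unit" "l \<notin> C" for C
  proof -
    have C1: "C \<inter> {l<..} \<in> sets borel_unit" and C2: "C \<inter> {..<l} \<in> sets borel_unit"
      using C by (auto simp: sets_unit)
    have "e (C \<inter> {l<..}) x = 0" by (rule e_eigenvector_one_side[OF x C1, of 1]) auto
    moreover have "e (C \<inter> {..<l}) x = 0" by (rule e_eigenvector_one_side[OF x C2, of "-1"]) auto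
    moreover have "e ((C \<inter> {l<..}) \<union> (C \<inter> {..<l})) x = e (C \<inter> {l<..}) x + e (C \<inter> {..<l}) x"
      by (rule e_Un[OF C1 C2 _ x(1)]) auto
    moreover have "(C \<inter> {l<..}) \<union> (C \<inter> {..<l}) = C" using C(2) by auto (metis linorder_neqE)
    ultimately show ?thesis by simp
  qed
  have "{-1..1} - B \<in> sets borel_unit" using B by (auto simp: sets_unit)
  from off[OF this] off[OF B] e_compl[OF x(1) B] show ?thesis by auto
qed

text \<open>By symmetry of \<open>e\<close>, pairing \<open>e B x\<close> with an eigenvector
  expansion of \<open>x\<close> keeps exactly the terms whose eigenvalue lies in
  \<open>B\<close>.\<close>

lemma e_inner_limit:
  assumes x: "ell2_supported A x" and B: "B \<in> sets borel_unit"
    and lim: "(\<lambda>N. \<Sum>i\<in>I N. f i) \<longlonglongrightarrow> x"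
    and f: "\<And>i. ell2_supported A (f i)" "\<And>i. T (f i) = l i *\<^sub>R f i"
  shows "(\<lambda>N. \<Sum>i\<in>I N. if l i \<in> B then f i \<bullet> x else 0) \<longlonglongrightarrow> e B x \<bullet> x"
proof -
  have "(\<lambda>N. e B x \<bullet> (\<Sum>i\<in>I N. f i)) \<longlonglongrightarrow> e B x \<bullet> x"
    by (intro tendsto_intros lim)
  moreover have "e B x \<bullet> f i = (if l i \<in> B then f i \<bullet> x else 0)" for i
    using e_sym[OF B x f(1)] e_eigenvector[OF f B, of i] by (simp add: inner_commute)
  ultimately show ?thesis by (simp add: inner_sum_right)
qed

end

section \<open>Random walks on groups\<close>

text \<open>The value 0 off \<open>D\<close> means that \<pi> has to be injective on
  \<open>D\<close> only, as translations are on the carrier of a group.\<close>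

definition ell2_pull :: "'a set \<Rightarrow> ('a \<Rightarrow> 'a) \<Rightarrow> 'a ell2 \<Rightarrow> 'a ell2"
  where "ell2_pull D \<pi> f = Abs_ell2 (\<lambda>x. if x \<in> D then ell2_fun f (\<pi> x) else 0)"

lemma ell2_pull_finite_sums:
  assumes "inj_on \<pi> D" "finite F"
  shows "(\<Sum>x\<in>F. (cmod (if x \<in> D then ell2_fun f (\<pi> x) else 0))\<^sup>2) \<le> (norm f)\<^sup>2"
proof -
  have "(\<Sum>x\<in>F. (cmod (if x \<in> D then ell2_fun f (\<pi> x) else 0))\<^sup>2) =
      (\<Sum>x\<in>F \<inter> D. (cmod (ell2_fun f (\<pi> x)))\<^sup>2)"
    using assms(2) by (intro sum.mono_neutral_cong_right) auto
  also have "\<dots> = (\<Sum>y\<in>\<pi> ` (F \<inter> D). (cmod (ell2_fun f y))\<^sup>2)"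
    using assms(1) by (subst sum.reindex) (auto intro: inj_on_subset)
  also have "\<dots> \<le> (norm f)\<^sup>2" using assms(2) by (intro ell2_sum_le_norm) auto
  finally show ?thesis .
qed

lemma ell2_fun_pull:
  assumes "inj_on \<pi> D"
  shows "ell2_fun (ell2_pull D \<pi> f) = (\<lambda>x. if x \<in> D then ell2_fun f (\<pi> x) else 0)"
  unfolding ell2_pull_def
proof (rule Abs_ell2_inverse, rule CollectI, rule nonneg_bdd_above_summable_on)
  show "bdd_above (sum (\<lambda>x. (cmod (if x \<in> D then ell2_fun f (\<pi> x) else 0))\<^sup>2) ` {F. F \<subseteq> UNIV \<and> finite F})"
    using ell2_pull_finite_sums[OF assms] by (intro bdd_aboveI2[of _ _ "(norm f)\<^sup>2"]) auto
qed auto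

lemma norm_ell2_pull_le:
  assumes "inj_on \<pi> D" shows "norm (ell2_pull D \<pi> f) \<le> norm f"
proof (rule power2_le_imp_le)
  show "(norm (ell2_pull D \<pi> f))\<^sup>2 \<le> (norm f)\<^sup>2"
    by (rule has_sum_le_finite_sums[OF ell2_norm_has_sum])
      (use ell2_pull_finite_sums[OF assms] in \<open>simp add: ell2_fun_pull[OF assms]\<close>)
qed simp

lemma ell2_eqI: "(\<And>x. ell2_fun f x = ell2_fun g x) \<Longrightarrow> f = g"
  by (simp add: ell2_fun_inject[symmetric] fun_eq_iff)

lemma bounded_linear_ell2_pull:
  assumes "inj_on \<pi> D" shows "bounded_linear (ell2_pull D \<pi>)"
  by (rule bounded_linear_intro[where K = 1])
    (auto intro!: ell2_eqI simp: ell2_fun_pull[OF assms] norm_ell2_pull_le[OF assms]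
      plus_ell2.rep_eq scaleR_ell2.rep_eq)

lemma ell2_pull_inner:
  assumes \<pi>: "\<pi> \<in> D \<rightarrow> D" and \<sigma>: "\<sigma> \<in> D \<rightarrow> D"
    and "\<And>x. x \<in> D \<Longrightarrow> \<sigma> (\<pi> x) = x" "\<And>x. x \<in> D \<Longrightarrow> \<pi> (\<sigma> x) = x"
  shows "ell2_pull D \<pi> f \<bullet> g = f \<bullet> ell2_pull D \<sigma> g"
proof -
  have inj: "inj_on \<pi> D" "inj_on \<sigma> D" using assms(3,4) by (auto intro: inj_on_inverseI)
  have bij: "bij_betw \<pi> D D" using assms by (intro bij_betwI[where g = \<sigma>]) auto
  have "ell2_pull D \<pi> f \<bullet> g = (\<Sum>\<^sub>\<infinity>x\<in>D. ell2_fun f (\<pi> x) \<bullet> ell2_fun g x)"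
    unfolding inner_ell2_def
    by (rule infsum_cong_neutral) (auto simp: ell2_fun_pull[OF inj(1)])
  also have "\<dots> = (\<Sum>\<^sub>\<infinity>x\<in>D. ell2_fun f (\<pi> x) \<bullet> ell2_fun g (\<sigma> (\<pi> x)))"
    by (rule infsum_cong) (simp add: assms)
  also have "\<dots> = (\<Sum>\<^sub>\<infinity>y\<in>D. ell2_fun f y \<bullet> ell2_fun g (\<sigma> y))"
    by (rule infsum_reindex_bij_betw[OF bij])
  also have "\<dots> = f \<bullet> ell2_pull D \<sigma> g"
    unfolding inner_ell2_def
    by (rule infsum_cong_neutral) (auto simp: ell2_fun_pull[OF inj(2)])
  finally show ?thesis .
qed

lift_definition ell2_delta :: "'a \<Rightarrow> 'a ell2" is "\<lambda>a x. if x = a then 1 else 0"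
  by (rule finite_nonzero_values_imp_summable_on) (rule finite_subset[of _ "{_}"], auto)

lemma ell2_inner_delta: "f \<bullet> ell2_delta a = Re (ell2_fun f a)"
proof -
  have "f \<bullet> ell2_delta a = (\<Sum>\<^sub>\<infinity>x\<in>{a}. ell2_fun f x \<bullet> ell2_fun (ell2_delta a) x)"
    unfolding inner_ell2_def by (rule infsum_cong_neutral) (auto simp: ell2_delta.rep_eq)
  then show ?thesis by (simp add: ell2_delta.rep_eq inner_complex_def)
qed

lemma ell2_restrict_finite:
  assumes "finite F"
  shows "ell2_restrict F f =
    (\<Sum>x\<in>F. Re (ell2_fun f x) *\<^sub>R ell2_delta x + Im (ell2_fun f x) *\<^sub>R ell2_i (ell2_delta x))"
  using assms
  by (intro ell2_eqI)
    (auto simp: ell2_restrict.rep_eq ell2_fun_sum plus_ell2.rep_eq scaleR_ell2.rep_eq ell2_i.rep_eq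
      ell2_delta.rep_eq complex_eq_iff if_distrib sum.distrib cong: if_cong)

lemma ell2_finite_support_dense:
  assumes "e > 0" shows "\<exists>F. finite F \<and> norm (f - ell2_restrict F f) < e"
proof -
  \<comment> \<open>The approximation is non-strict; halving \<open>e\<^sup>2\<close> makes the
    final inequality strict.\<close>
  obtain F where F: "finite F" "dist (\<Sum>x\<in>F. (cmod (ell2_fun f x))\<^sup>2) ((norm f)\<^sup>2) \<le> e\<^sup>2 / 2"
    using has_sum_finite_approximation[OF ell2_norm_has_sum, of "e\<^sup>2 / 2" f] assms by auto
  have "ell2_restrict F f \<bullet> ell2_restrict F f = (\<Sum>x\<in>F. (cmod (ell2_fun f x))\<^sup>2)"
  proof (rule has_sum_unique[OF ell2_inner_has_sum])
    show "((\<lambda>x. ell2_fun (ell2_restrict F f) x \<bullet> ell2_fun (ell2_restrict F f) x) has_sum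
        (\<Sum>x\<in>F. (cmod (ell2_fun f x))\<^sup>2)) UNIV"
      using F(1) by (intro has_sum_finite_neutralI[where B = F])
        (auto simp: ell2_restrict.rep_eq power2_norm_eq_inner)
  qed
  moreover have "f \<bullet> ell2_restrict F f = (\<Sum>x\<in>F. (cmod (ell2_fun f x))\<^sup>2)"
  proof (rule has_sum_unique[OF ell2_inner_has_sum])
    show "((\<lambda>x. ell2_fun f x \<bullet> ell2_fun (ell2_restrict F f) x) has_sum
        (\<Sum>x\<in>F. (cmod (ell2_fun f x))\<^sup>2)) UNIV"
      using F(1) by (intro has_sum_finite_neutralI[where B = F])
        (auto simp: ell2_restrict.rep_eq power2_norm_eq_inner)
  qed
  ultimately have "(norm (f - ell2_restrict F f))\<^sup>2 = (norm f)\<^sup>2 - (\<Sum>x\<in>F. (cmod (ell2_fun f x))\<^sup>2)"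
    by (simp add: power2_norm_eq_inner inner_diff_left inner_diff_right inner_commute)
  also have "\<dots> \<le> e\<^sup>2 / 2" using F(2) unfolding dist_real_def by linarith
  also have "\<dots> < e\<^sup>2" using assms by simp
  finally have "norm (f - ell2_restrict F f) < e" using assms by (simp add: power2_less_imp_less)
  with F(1) show ?thesis by blast
qed

locale random_walk = group \<Lambda> for \<Lambda> :: "('a, 'b) monoid_scheme" (structure) +
  fixes S :: "'a set"
  assumes finite_S: "finite S" and S_nonempty: "S \<noteq> {}" and S_carrier: "S \<subseteq> carrier \<Lambda>"
    and S_inv: "s \<in> S \<Longrightarrow> inv s \<in> S"
begin

definition T :: "'a ell2 \<Rightarrow> 'a ell2"
  where "T f = (\<Sum>s\<in>S. ell2_pull (carrier \<Lambda>) (\<lambda>g. s \<otimes> g) f) /\<^sub>R real (card S)"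

lemma inj_left: "s \<in> S \<Longrightarrow> inj_on (\<lambda>g. s \<otimes> g) (carrier \<Lambda>)"
  using S_carrier by (auto intro!: inj_onI)

lemma inj_right: "h \<in> carrier \<Lambda> \<Longrightarrow> inj_on (\<lambda>g. g \<otimes> h) (carrier \<Lambda>)"
  by (auto intro!: inj_onI)

lemma card_S_pos: "card S > 0"
  using finite_S S_nonempty by (simp add: card_gt_0_iff)

lemma ell2_fun_T: "ell2_fun (T f) = markov_operator \<Lambda> S (ell2_fun f)"
  by (auto simp: fun_eq_iff T_def markov_operator_def scaleR_ell2.rep_eq ell2_fun_sum ell2_fun_pull inj_left
      scaleR_conv_of_real field_simps)

lemma bounded_linear_T: "bounded_linear T"
  unfolding T_def
  by (intro bounded_linear_const_scaleR bounded_linear_sum bounded_linear_ell2_pull inj_left)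

text \<open>The adjoint of translation by \<open>s\<close> is translation by \<open>inv s\<close>,
  and inversion permutes the generators.\<close>

lemma T_sym: "T f \<bullet> g = f \<bullet> T g"
proof -
  have "(\<Sum>s\<in>S. ell2_pull (carrier \<Lambda>) (\<lambda>x. s \<otimes> x) f \<bullet> g) =
      (\<Sum>s\<in>S. f \<bullet> ell2_pull (carrier \<Lambda>) (\<lambda>x. inv s \<otimes> x) g)"
  proof (rule sum.cong)
    fix s assume "s \<in> S"
    then have s: "s \<in> carrier \<Lambda>" using S_carrier by auto
    show "ell2_pull (carrier \<Lambda>) (\<lambda>x. s \<otimes> x) f \<bullet> g = f \<bullet> ell2_pull (carrier \<Lambda>) (\<lambda>x. inv s \<otimes> x) g"
      by (rule ell2_pull_inner) (use s in \<open>auto simp flip: m_assoc\<close>)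
  qed simp
  also have "\<dots> = (\<Sum>s\<in>S. f \<bullet> ell2_pull (carrier \<Lambda>) (\<lambda>x. s \<otimes> x) g)"
    by (rule sum.reindex_bij_witness[where i = "\<lambda>s. inv s" and j = "\<lambda>s. inv s"])
      (use S_inv S_carrier in auto)
  finally show ?thesis by (simp add: T_def inner_sum_left inner_sum_right)
qed

lemma T_i: "T (ell2_i f) = ell2_i (T f)"
  by (rule ell2_eqI)
    (simp add: ell2_fun_T markov_operator_def ell2_i.rep_eq sum_distrib_left)

lemma T_supported: "ell2_supported (carrier \<Lambda>) (T f)"
  by (simp add: ell2_supported_def ell2_fun_T markov_operator_def)

lemma T_restrict: "T (ell2_restrict (carrier \<Lambda>) f) = T f"
  using S_carrier
  by (intro ell2_eqI) (auto simp: ell2_fun_T markov_operator_def ell2_restrict.rep_eq subset_iff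
      intro!: sum.cong arg_cong[where f = "\<lambda>z. z / _"])

lemma T_contraction: "norm (T f) \<le> norm f"
proof -
  have "norm (\<Sum>s\<in>S. ell2_pull (carrier \<Lambda>) (\<lambda>g. s \<otimes> g) f) \<le> (\<Sum>s\<in>S. norm f)"
    by (rule order.trans[OF norm_sum]) (intro sum_mono norm_ell2_pull_le inj_left)
  then show ?thesis using card_S_pos by (simp add: T_def field_simps)
qed

lemma T_right:
  assumes "h \<in> carrier \<Lambda>"
  shows "T (ell2_pull (carrier \<Lambda>) (\<lambda>g. g \<otimes> h) f) = ell2_pull (carrier \<Lambda>) (\<lambda>g. g \<otimes> h) (T f)"
  using S_carrier assms
  by (intro ell2_eqI) (auto simp: ell2_fun_T ell2_fun_pull inj_right markov_operator_def m_assoc subset_iff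
      intro!: sum.cong arg_cong[where f = "\<lambda>z. z / _"])

text \<open>Right translations commute with the walk, so the closed span of the eigenvectors contains all
  point masses as soon as it contains the one at the identity.\<close>

lemma pure_point_operatorI:
  assumes one: "ell2_delta \<one> \<in> closure (span {x. \<exists>l. T x = l *\<^sub>R x})"
  shows "pure_point_operator T"
proof (rule pure_point_operator.intro)
  let ?K = "closure (span {x. \<exists>l. T x = l *\<^sub>R x})"
  have sub: "subspace ?K" by (simp add: subspace_closure)
  have eig: "x \<in> ?K" if "T x = l *\<^sub>R x" for x l
    using that closure_subset by (fastforce intro: span_base)
  \<comment> \<open>Bounded operators commuting with the walk preserve the closed span; used for
    right translations and for multiplication by i.\<close>
  have inv: "U x \<in> ?K" if U: "bounded_linear U" "\<And>x. U (T x) = T (U x)" and x: "x \<in> ?K" for U x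
  proof -
    have "?K \<subseteq> {x. U x \<in> ?K}"
    proof (intro closure_minimal span_minimal)
      show "{x. \<exists>l. T x = l *\<^sub>R x} \<subseteq> {x. U x \<in> ?K}"
      proof safe
        fix x l assume "T x = l *\<^sub>R x"
        then have "T (U x) = l *\<^sub>R U x" by (simp flip: U(2) add: linear_simps[OF U(1)])
        then show "U x \<in> ?K" by (rule eig)
      qed
      show "subspace {x. U x \<in> ?K}"
        by (rule subspaceI)
          (auto simp: linear_simps[OF U(1)] subspace_0 subspace_add subspace_scale sub)
      have "closed (U -` ?K)"
        by (intro continuous_closed_vimage closed_closure linear_continuous_at U)
      then show "closed {x. U x \<in> ?K}" by (simp add: vimage_def)
    qed
    then show ?thesis using x by auto
  qed
  have delta: "ell2_delta x \<in> ?K" for x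
  proof (cases "x \<in> carrier \<Lambda>")
    case True
    have "y \<otimes> inv x = \<one> \<longleftrightarrow> y = x" if y: "y \<in> carrier \<Lambda>" for y
    proof
      assume "y \<otimes> inv x = \<one>"
      then have "y \<otimes> inv x \<otimes> x = x" using True by simp
      then show "y = x" using True y by (simp add: m_assoc)
    qed (use True in simp)
    then have "ell2_delta x = ell2_pull (carrier \<Lambda>) (\<lambda>g. g \<otimes> inv x) (ell2_delta \<one>)"
      using True by (intro ell2_eqI) (auto simp: ell2_fun_pull inj_right ell2_delta.rep_eq)
    also have "\<dots> \<in> ?K"
      by (rule inv[OF bounded_linear_ell2_pull[OF inj_right] _ one]) (use True in \<open>simp_all add: T_right\<close>)
    finally show ?thesis .
  next
    case False
    \<comment> \<open>Outside the group the point mass is annihilated, hence an eigenvector for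
      0.\<close>
    have "T (ell2_delta x) = 0 *\<^sub>R ell2_delta x"
      using False S_carrier
      by (intro ell2_eqI) (auto simp: ell2_fun_T markov_operator_def ell2_delta.rep_eq zero_ell2.rep_eq subset_iff intro!: sum.neutral)
    then show ?thesis by (rule eig)
  qed
  have "f \<in> ?K" for f
  proof -
    have "\<exists>y\<in>?K. dist y f < e" if "e > 0" for e
    proof -
      obtain F where F: "finite F" "norm (f - ell2_restrict F f) < e"
        using ell2_finite_support_dense[OF \<open>e > 0\<close>] by blast
      have "ell2_restrict F f \<in> ?K"
        unfolding ell2_restrict_finite[OF F(1)]
        by (intro subspace_sum subspace_add subspace_scale sub delta inv[OF bounded_linear_ell2_i])
          (simp add: T_i)
      with F show ?thesis by (auto simp: dist_norm norm_minus_commute)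
    qed
    then have "f \<in> closure ?K" unfolding closure_approachable[of f ?K] by blast
    then show ?thesis by simp
  qed
  then show "?K = UNIV" by auto
qed (auto intro: bounded_linear_T T_sym)

text \<open>The expansion serves twice: it makes the eigenvectors total, so that a resolution exists
  and the choice operator returns one, and then it evaluates that resolution at the point mass.
  Pairing with the point mass reads off the value at the identity.\<close>

lemma emeasure_kesten_spectral_measure:
  assumes lim: "(\<lambda>N. \<Sum>i\<in>I N. f i) \<longlonglongrightarrow> ell2_delta \<one>"
    and f: "\<And>i. ell2_supported (carrier \<Lambda>) (f i)" "\<And>i. T (f i) = l i *\<^sub>R f i"
    and B: "B \<in> sets borel" "B \<subseteq> {-1..1}"
  shows "\<exists>c. emeasure (kesten_spectral_measure \<Lambda> S) B = ennreal c \<and>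
    (\<lambda>N. \<Sum>i\<in>I N. if l i \<in> B then Re (ell2_fun (f i) \<one>) else 0) \<longlonglongrightarrow> c"
proof -
  let ?K = "closure (span {x. \<exists>l. T x = l *\<^sub>R x})"
  have "ell2_delta \<one> \<in> ?K"
  proof (rule closed_sequentially[OF closed_closure _ lim])
    show "(\<Sum>i\<in>I N. f i) \<in> ?K" for N
      using f(2) closure_subset by (intro subsetD[OF closure_subset] span_sum span_base) auto
  qed
  then interpret pure_point_operator T by (rule pure_point_operatorI)
  interpret ell2_pure_point T "carrier \<Lambda>" "markov_operator \<Lambda> S"
    by unfold_locales (auto simp: T_i T_supported T_restrict T_contraction ell2_fun_T)
  define E where "E = (SOME E. spectral_resolution (carrier \<Lambda>) (markov_operator \<Lambda> S) E)"
  have E: "spectral_resolution (carrier \<Lambda>) (markov_operator \<Lambda> S) E"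
    unfolding E_def using spectral_resolution_resolution
    by (rule someI[of "spectral_resolution (carrier \<Lambda>) (markov_operator \<Lambda> S)"])
  interpret ell2_resolution T "carrier \<Lambda>" "markov_operator \<Lambda> S" E
    using E by unfold_locales (auto simp: spectral_resolution_def)
  have B': "B \<in> sets borel_unit" using B by (auto simp: sets_restrict_space_iff)
  have d: "ell2_supported (carrier \<Lambda>) (ell2_delta \<one>)"
    by (auto simp: ell2_supported_def ell2_delta.rep_eq)
  have "kesten_spectral_measure \<Lambda> S = \<mu> (ell2_delta \<one>)"
    by (simp add: kesten_spectral_measure_def E_def ell2_delta.rep_eq)
  then have "emeasure (kesten_spectral_measure \<Lambda> S) B = ennreal (e B (ell2_delta \<one>) \<bullet> ell2_delta \<one>)"
    using emeasure_scalar_measure[OF B' d] e_inner_self[OF B' d] by simp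
  then show ?thesis
    using e_inner_limit[OF d B' lim f] by (auto simp: ell2_inner_delta cong: if_cong)
qed

end

section \<open>Trigonometric sums and rearrangements\<close>

lemma sum_cos_multiples:
  fixes x :: real
  shows "2 * sin (x / 2) * (\<Sum>k<n. cos (real k * x)) = sin (real n * x - x / 2) + sin (x / 2)"
proof (induction n)
  case (Suc n)
  have "sin (real (Suc n) * x - x / 2) = sin (real n * x + x / 2)"
    by (simp add: algebra_simps)
  then show ?case
    using Suc by (simp add: algebra_simps sin_add sin_diff)
qed simp

text \<open>The Dirichlet kernel at x = pi l / n, where n x is a multiple of pi. The range of
  \<open>l\<close> keeps sin (x / 2) away from 0.\<close>

lemma sum_cos_roots:
  assumes "0 < l" "l < 2 * n"
  shows "(\<Sum>k<n. cos (real k * (pi * real l / real n))) = (1 - (-1) ^ l) / 2"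
proof -
  let ?x = "pi * real l / real n"
  have "0 < ?x / 2" "?x / 2 < pi" using assms by (auto simp: field_simps)
  then have s: "sin (?x / 2) > 0" by (rule sin_gt_zero)
  have "real n * ?x - ?x / 2 = real l * pi - ?x / 2" using assms by simp
  then have "sin (real n * ?x - ?x / 2) = - ((-1) ^ l * sin (?x / 2))"
    by (simp add: sin_diff cos_npi mult.commute[of pi])
  with sum_cos_multiples[of ?x n]
  have "sin (?x / 2) * (2 * (\<Sum>k<n. cos (real k * ?x))) = sin (?x / 2) * (1 - (-1) ^ l)"
    by (simp only: algebra_simps)
  then have "2 * (\<Sum>k<n. cos (real k * ?x)) = 1 - (-1) ^ l"
    using s by (simp only: mult_cancel_left) auto
  then show ?thesis by simp
qed

text \<open>The product formula gives cosine sums for j - i and j + i. These have equal parity, so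
  the sums cancel unless i = j, when the first one is n. Assuming i \<le> j keeps j - i a natural
  number.\<close>

lemma sum_sin_sin_roots_le:
  assumes "1 \<le> i" "i \<le> j" "j < n"
  shows "(\<Sum>k=1..<n. sin (pi * real k * real i / real n) * sin (pi * real k * real j / real n)) =
    (if i = j then real n / 2 else 0)"
proof -
  let ?c = "\<lambda>l k. cos (real k * (pi * real l / real n))"
  have "(\<Sum>k=1..<n. sin (pi * real k * real i / real n) * sin (pi * real k * real j / real n)) =
      (\<Sum>k<n. sin (pi * real k * real i / real n) * sin (pi * real k * real j / real n))"
    by (rule sum.mono_neutral_left) (auto simp: Suc_le_eq)
  also have "\<dots> = (\<Sum>k<n. (?c (j - i) k - ?c (j + i) k) / 2)"
  proof (rule sum.cong)
    fix k
    have "real k * (pi * real (j - i) / real n) = pi * real k * real j / real n - pi * real k * real i / real n"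
      "real k * (pi * real (j + i) / real n) = pi * real k * real j / real n + pi * real k * real i / real n"
      using assms by (simp_all add: of_nat_diff diff_divide_distrib add_divide_distrib algebra_simps)
    then show "sin (pi * real k * real i / real n) * sin (pi * real k * real j / real n) =
        (?c (j - i) k - ?c (j + i) k) / 2"
      by (simp only: sin_times_sin[symmetric] mult.commute[of "sin (pi * real k * real i / real n)"])
  qed simp
  also have "\<dots> = ((\<Sum>k<n. ?c (j - i) k) - (\<Sum>k<n. ?c (j + i) k)) / 2"
    by (simp add: sum_subtractf flip: sum_divide_distrib)
  also have "(\<Sum>k<n. ?c (j + i) k) = (1 - (-1) ^ (j + i)) / 2"
    using assms by (intro sum_cos_roots) auto
  also have "(\<Sum>k<n. ?c (j - i) k) = (if i = j then real n else (1 - (-1) ^ (j - i)) / 2)"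
    using assms by (cases "i = j") (simp, simp only: if_False, intro sum_cos_roots, auto)
  also have "(-1 :: real) ^ (j + i) = (-1) ^ (j - i)"
    using assms by (auto simp: minus_one_power_iff)
  finally show ?thesis by (auto simp: minus_one_power_iff)
qed

text \<open>Used in both directions: summed over frequencies it expands a point mass on the path,
  summed over positions it normalises an eigenvector.\<close>

lemma sum_sin_sin_roots:
  assumes "1 \<le> i" "i < n" "1 \<le> j" "j < n"
  shows "(\<Sum>k=1..<n. sin (pi * real k * real i / real n) * sin (pi * real k * real j / real n)) =
    (if i = j then real n / 2 else 0)"
  using sum_sin_sin_roots_le[of i j n] sum_sin_sin_roots_le[of j i n] assms
  by (cases "i \<le> j") (auto simp: mult.commute)

text \<open>For nonnegative terms convergence along growing squares is unconditional, which permits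
  regrouping along antidiagonals.\<close>

lemma has_sum_of_square_sums:
  fixes g :: "nat \<times> nat \<Rightarrow> real"
  assumes nonneg: "\<And>x. g x \<ge> 0" and lim: "(\<lambda>N. \<Sum>x\<in>{..N}\<times>{..N}. g x) \<longlonglongrightarrow> c"
  shows "(g has_sum c) UNIV"
proof -
  have inc: "incseq (\<lambda>N. \<Sum>x\<in>{..N}\<times>{..N}. g x)"
    by (intro monoI sum_mono2) (auto simp: nonneg)
  have square: "\<exists>M. F \<subseteq> {..M} \<times> {..M}" if "finite F" for F :: "(nat \<times> nat) set"
  proof -
    have "finite (fst ` F \<union> snd ` F)" using that by simp
    then obtain M where "\<forall>n\<in>fst ` F \<union> snd ` F. n \<le> M"
      unfolding finite_nat_set_iff_bounded_le by blast
    then have "F \<subseteq> {..M} \<times> {..M}" by (auto simp: subset_iff mem_Times_iff)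
    then show ?thesis ..
  qed
  have "g summable_on UNIV"
  proof (rule nonneg_bdd_above_summable_on)
    have "sum g F \<le> c" if fin: "finite F" for F
    proof -
      obtain M where M: "F \<subseteq> {..M} \<times> {..M}" using square[OF fin] ..
      then have "sum g F \<le> sum g ({..M} \<times> {..M})" by (intro sum_mono2) (auto simp: nonneg)
      also have "\<dots> \<le> c" using incseq_le[OF inc lim] .
      finally show ?thesis .
    qed
    then show "bdd_above (sum g ` {F. F \<subseteq> UNIV \<and> finite F})" by (intro bdd_aboveI2[of _ _ c]) auto
  qed (rule nonneg)
  then have s: "(g has_sum infsum g UNIV) UNIV" by simp
  \<comment> \<open>The squares are cofinal among the finite sets, so the unconditional sum equals
    the given limit.\<close>
  have "filterlim (\<lambda>N. {..N} \<times> {..N}) (finite_subsets_at_top UNIV) sequentially"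
    unfolding filterlim_finite_subsets_at_top
  proof (intro allI impI)
    fix F :: "(nat \<times> nat) set" assume "finite F \<and> F \<subseteq> UNIV"
    then have "finite F" ..
    from square[OF this] obtain M where M: "F \<subseteq> {..M} \<times> {..M}" ..
    have "F \<subseteq> {..N} \<times> {..N}" if "N \<ge> M" for N
      by (rule order.trans[OF M]) (use that in auto)
    then show "\<forall>\<^sub>F N in sequentially. finite ({..N} \<times> {..N}) \<and> F \<subseteq> {..N} \<times> {..N} \<and> {..N} \<times> {..N} \<subseteq> UNIV"
      by (auto simp: eventually_sequentially)
  qed
  from filterlim_compose[OF s[unfolded has_sum_def] this] lim have "infsum g UNIV = c"
    by (rule LIMSEQ_unique)
  with s show ?thesis by simp
qed

text \<open>Collects the segments with the same path parameter q = a + b + 2; the range a < q - 1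
  keeps the truncated subtraction exact.\<close>

lemma has_sum_antidiagonals:
  fixes g :: "nat \<times> nat \<Rightarrow> real"
  assumes "(g has_sum c) UNIV"
  shows "((\<lambda>q. \<Sum>a<q-1. g (a, q - 2 - a)) has_sum c) {2..}"
proof (rule has_sum_SigmaD)
  show "((\<lambda>(q, a). g (a, q - 2 - a)) has_sum c) (SIGMA q:{2..}. {..<q-1})"
    using assms
    by (subst has_sum_reindex_bij_witness[where T = UNIV and h = g and s' = c
          and i = "\<lambda>(a, b). (a + b + 2, a)" and j = "\<lambda>(q, a). (a, q - 2 - a)"]) auto
qed (auto intro: has_sum_finiteI)

text \<open>Every fraction \<open>k / Q\<close> in \<open>(0, 1)\<close> is \<open>m p / (m q)\<close> for a unique reduced fraction \<open>p / q\<close>,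
  and the weights \<open>x ^ (m q)\<close> form a geometric series.\<close>

lemma has_sum_reduced_fractions:
  fixes x c :: real and P :: "real \<Rightarrow> bool"
  assumes x: "0 < x" "x < 1"
    and sum: "((\<lambda>q. x ^ q * (\<Sum>k=1..<q. of_bool (P (real k / real q)))) has_sum c) {2..}"
  shows "((\<lambda>q. \<Sum>p | 1 \<le> p \<and> p < q \<and> coprime p q. x ^ q / (1 - x ^ q) * of_bool (P (real p / real q)))
    has_sum c) {2..}"
proof -
  let ?R = "\<lambda>q::nat. {p. 1 \<le> p \<and> p < q \<and> coprime p q}"
  let ?X = "Sigma {2..} ?R" and ?Z = "SIGMA q:{2..}. {1..<q}"
  let ?w = "\<lambda>(q, k). x ^ q * of_bool (P (real k / real q)) :: real"
  have inner: "((\<lambda>k. ?w (q, k)) has_sum x ^ q * (\<Sum>k=1..<q. of_bool (P (real k / real q)))) {1..<q}" for q :: nat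
    by (intro has_sum_finiteI) (auto simp: sum_distrib_left)
  \<comment> \<open>Nonnegative terms with summable row sums are summable over all pairs, so the
    fractions may be regrouped freely.\<close>
  have "?w summable_on ?Z"
    by (rule summable_on_SigmaI[OF inner has_sum_imp_summable[OF sum]]) (use x in auto)
  with inner sum have "(?w has_sum c) ?Z" by (rule has_sum_SigmaI)
  also have "(?w has_sum c) ?Z \<longleftrightarrow>
      ((\<lambda>((q, p), m). x ^ (m * q) * of_bool (P (real p / real q))) has_sum c) (?X \<times> {1..})"
  proof (rule has_sum_reindex_bij_witness[where
        i = "\<lambda>((q, p), m). (m * q, m * p)" and
        j = "\<lambda>(q, k). ((q div gcd q k, k div gcd q k), gcd q k)"], goal_cases)
    case (2 a)
    then obtain q k where a: "a = (q, k)" "2 \<le> q" "1 \<le> k" "k < q" by auto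
    define g where "g = gcd q k"
    obtain q' where q': "q = g * q'" using gcd_dvd1[of q k] unfolding g_def by (rule dvdE)
    obtain k' where k': "k = g * k'" using gcd_dvd2[of q k] unfolding g_def by (rule dvdE)
    note qk = q' k'
    have "g > 0" using a by (simp add: g_def)
    moreover have "coprime k' q'"
    proof (rule gcd_coprime[of k q])
      show "gcd k q \<noteq> 0" using a by simp
      show "k = k' * gcd k q" "q = q' * gcd k q"
        using q' k' unfolding g_def by (simp_all only: gcd.commute mult.commute)
    qed
    moreover have "k' > 0" "k' < q'" using qk a by auto
    ultimately have "q' \<ge> 2 \<and> k' \<ge> 1 \<and> k' < q' \<and> coprime k' q' \<and> g \<ge> 1" by linarith
    moreover have "q div g = q'" "k div g = k'" using q' k' \<open>g > 0\<close> by simp_all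
    ultimately show ?case by (auto simp: a g_def[symmetric])
  next
    case (3 b)
    then obtain q p m where b: "b = ((q, p), m)" "2 \<le> q" "1 \<le> p" "p < q" "coprime p q" "m \<ge> 1" by auto
    then have "gcd (m * q) (m * p) = m"
      by (simp add: gcd_mult_distrib_nat[symmetric] coprime_iff_gcd_eq_1 gcd.commute)
    then show ?case using b by simp
  next
    case (4 b)
    then obtain q p m where b: "b = ((q, p), m)" "2 \<le> q" "1 \<le> p" "p < q" "m \<ge> 1" by auto
    then have "2 \<le> m * q" "1 \<le> m * p" using mult_le_mono[of 1 m 2 q] by auto
    then show ?case using b by auto
  next
    case (5 a)
    then obtain q k where a: "a = (q, k)" "2 \<le> q" "1 \<le> k" "k < q" by auto
    have "real (k div gcd q k) / real (q div gcd q k) = real k / real q"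
      using a by (simp add: real_of_nat_div)
    then show ?case by (simp add: a)
  qed auto
  finally have "((\<lambda>((q, p), m). x ^ (m * q) * of_bool (P (real p / real q))) has_sum c) (?X \<times> {1..})" .
  then have "((\<lambda>(q, p). x ^ q / (1 - x ^ q) * of_bool (P (real p / real q))) has_sum c) ?X"
  proof (rule has_sum_SigmaD)
    fix y assume "y \<in> ?X"
    then obtain q p where y: "y = (q, p)" "q \<ge> 2" by auto
    have "norm (x ^ q) < 1" using x y by (simp add: power_less_one_iff)
    then have "((\<lambda>m. (x ^ q) ^ m * of_bool (P (real p / real q))) has_sum
        x ^ q / (1 - x ^ q) * of_bool (P (real p / real q))) {1..}"
      by (intro has_sum_cmult_left has_sum_geometric_from_1)
    then show "((\<lambda>m. (\<lambda>((q, p), m). x ^ (m * q) * of_bool (P (real p / real q))) (y, m)) has_sum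
        (\<lambda>(q, p). x ^ q / (1 - x ^ q) * of_bool (P (real p / real q))) y) {1..}"
      by (simp add: y power_mult[symmetric] mult.commute)
  qed
  then show ?thesis
    by (rule has_sum_SigmaD) (auto intro!: has_sum_finiteI finite_subset[of "?R _" "{..<_}"])
qed

lemma infsum_ennreal:
  assumes "(f has_sum c) A" "\<And>x. x \<in> A \<Longrightarrow> f x \<ge> 0"
  shows "(\<Sum>\<^sub>\<infinity>x\<in>A. ennreal (f x)) = ennreal c"
proof (rule infsumI)
  have "((\<lambda>F. ennreal (sum f F)) \<longlongrightarrow> ennreal c) (finite_subsets_at_top A)"
    using assms(1) unfolding has_sum_def by (rule tendsto_ennrealI)
  moreover have "\<forall>\<^sub>F F in finite_subsets_at_top A. ennreal (sum f F) = (\<Sum>x\<in>F. ennreal (f x))"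
    by (rule eventually_finite_subsets_at_top_weakI) (use assms(2) in \<open>auto simp: sum_ennreal subset_iff\<close>)
  ultimately show "((\<lambda>x. ennreal (f x)) has_sum ennreal c) A"
    unfolding has_sum_def by (rule Lim_transform_eventually)
qed

section \<open>Eigenfunctions of the walk on the wreath product\<close>

locale lamplighter = group G for G :: "('a, 'b) monoid_scheme" (structure) +
  assumes finite_G: "finite (carrier G)"
begin

section \<open>The walk in coordinates\<close>

abbreviation W where "W \<equiv> wreath_int G"
abbreviation n :: real where "n \<equiv> real (order G)"

sublocale W: group W by (rule group_wreath_int) unfold_locales

lemma n_pos: "n > 0"
  using finite_G by (simp add: order_gt_0_iff_finite)

lemma carrier_W: "(F, K) \<in> carrier W \<longleftrightarrow> (\<forall>i. F i \<in> carrier G) \<and> finite {i. F i \<noteq> \<one>}"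
  by (simp add: carrier_wreath_int is_group)

text \<open>The generator t g: the shift by t carries the lamp of g from coordinate 0 to 1. In g
  t^(-1), which is \<open>down g\<close>, it stays at 0.\<close>

definition up :: "'a \<Rightarrow> (int \<Rightarrow> 'a) \<times> int" where "up g = ((\<lambda>i. if i = 1 then g else \<one>), 1)"
definition down :: "'a \<Rightarrow> (int \<Rightarrow> 'a) \<times> int" where "down g = ((\<lambda>i. if i = 0 then g else \<one>), -1)"

lemma inv_wreath_t: "inv\<^bsub>W\<^esub> wreath_t G = ((\<lambda>_. \<one>), -1)"
  by (rule W.inv_equality)
    (auto simp: mult_wreath_int one_wreath_int wreath_t_def carrier_W)

lemma wreath_gens_eq: "wreath_gens G = up ` carrier G \<union> down ` carrier G"
proof -
  have "wreath_t G \<otimes>\<^bsub>W\<^esub> wreath_embed G g = up g" if "g \<in> carrier G" for g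
    using that by (auto simp: mult_wreath_int wreath_t_def wreath_embed_def up_def)
  moreover have "wreath_embed G g \<otimes>\<^bsub>W\<^esub> inv\<^bsub>W\<^esub> wreath_t G = down g" if "g \<in> carrier G" for g
    using that by (auto simp: inv_wreath_t mult_wreath_int wreath_embed_def down_def)
  ultimately show ?thesis
    by (simp add: wreath_gens_def Setcompr_eq_image cong: image_cong_simp)
qed

lemma sum_wreath_gens:
  fixes h :: "(int \<Rightarrow> 'a) \<times> int \<Rightarrow> 'c::comm_monoid_add"
  shows "(\<Sum>s\<in>wreath_gens G. h s) = (\<Sum>g\<in>carrier G. h (up g)) + (\<Sum>g\<in>carrier G. h (down g))"
proof -
  have "inj_on up (carrier G)" "inj_on down (carrier G)"
    by (auto intro!: inj_onI simp: up_def down_def fun_eq_iff split: if_splits)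
  moreover have "up ` carrier G \<inter> down ` carrier G = {}" by (auto simp: up_def down_def)
  ultimately show ?thesis
    unfolding wreath_gens_eq using finite_G by (simp add: sum.union_disjoint sum.reindex)
qed

lemma card_wreath_gens: "real (card (wreath_gens G)) = 2 * n"
  using sum_wreath_gens[of "\<lambda>_. 1 :: real"] by (simp add: order_def)

sublocale RW: random_walk W "wreath_gens G"
proof
  show "finite (wreath_gens G)" using finite_G by (rule finite_wreath_gens)
  show "wreath_gens G \<noteq> {}" by (auto simp: wreath_gens_eq)
qed (use wreath_gens_subset[OF is_group] wreath_gens_symmetric[OF is_group] in auto)

text \<open>In the frame of the walker the lamp configuration of \<open>(F, K)\<close> is \<open>\<lambda>i. F (i + K)\<close>, and the walker
  stands at \<open>- K\<close>. Moving from \<open>m\<close> to \<open>m - 1\<close> randomises lamp \<open>m\<close>: the lamps sit on the edges.\<close>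

lemma markov_operator_frame:
  fixes \<phi> :: "(int \<Rightarrow> 'a) \<Rightarrow> int \<Rightarrow> real"
  assumes FK: "(F, K) \<in> carrier W"
  defines "H \<equiv> (\<lambda>i. F (i + K))"
  shows "markov_operator W (wreath_gens G)
      (\<lambda>(F, K). if (F, K) \<in> carrier W then complex_of_real (\<phi> (\<lambda>i. F (i + K)) (- K)) else 0) (F, K) =
    complex_of_real (((\<Sum>g\<in>carrier G. \<phi> (H(- K := g \<otimes> H (- K))) (- K - 1)) +
      (\<Sum>g\<in>carrier G. \<phi> (H(- K + 1 := g \<otimes> H (- K + 1))) (- K + 1))) / (2 * n))"
proof -
  let ?f = "\<lambda>(F, K). if (F, K) \<in> carrier W then complex_of_real (\<phi> (\<lambda>i. F (i + K)) (- K)) else 0"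
  have F: "F i \<in> carrier G" for i using FK by (simp add: carrier_W)
  have "?f (up g \<otimes>\<^bsub>W\<^esub> (F, K)) = complex_of_real (\<phi> (H(- K := g \<otimes> H (- K))) (- K - 1))"
    if g: "g \<in> carrier G" for g
  proof -
    have mem: "up g \<otimes>\<^bsub>W\<^esub> (F, K) \<in> carrier W"
      by (rule W.m_closed[OF _ FK]) (use g RW.S_carrier in \<open>auto simp: wreath_gens_eq\<close>)
    have eq: "up g \<otimes>\<^bsub>W\<^esub> (F, K) = ((\<lambda>i. (if i = 1 then g else \<one>) \<otimes> F (i - 1)), 1 + K)"
      by (simp add: mult_wreath_int up_def)
    \<comment> \<open>The shift of the lamps and the increase of \<open>K\<close> cancel in the
      frame of the walker; the only change is at the lamp with i + 1 + K = 1.\<close>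
    have H: "(\<lambda>i. (if i + (1 + K) = 1 then g else \<one>) \<otimes> F (i + (1 + K) - 1)) = H(- K := g \<otimes> H (- K))"
      using F g by (auto simp: H_def fun_eq_iff algebra_simps)
    have "- (1 + K) = - K - 1" by simp
    with mem show ?thesis by (simp only: eq H prod.case if_True)
  qed
  moreover have "?f (down g \<otimes>\<^bsub>W\<^esub> (F, K)) = complex_of_real (\<phi> (H(- K + 1 := g \<otimes> H (- K + 1))) (- K + 1))"
    if g: "g \<in> carrier G" for g
  proof -
    have mem: "down g \<otimes>\<^bsub>W\<^esub> (F, K) \<in> carrier W"
      by (rule W.m_closed[OF _ FK]) (use g RW.S_carrier in \<open>auto simp: wreath_gens_eq\<close>)
    have eq: "down g \<otimes>\<^bsub>W\<^esub> (F, K) = ((\<lambda>i. (if i = 0 then g else \<one>) \<otimes> F (i + 1)), - 1 + K)"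
      by (simp add: mult_wreath_int down_def)
    have H: "(\<lambda>i. (if i + (- 1 + K) = 0 then g else \<one>) \<otimes> F (i + (- 1 + K) + 1)) =
        H(- K + 1 := g \<otimes> H (- K + 1))"
      using F g by (auto simp: H_def fun_eq_iff algebra_simps)
    have "- (- 1 + K) = - K + 1" by simp
    with mem show ?thesis by (simp only: eq H prod.case if_True)
  qed
  ultimately have "(\<Sum>s\<in>wreath_gens G. ?f (s \<otimes>\<^bsub>W\<^esub> (F, K))) =
      complex_of_real ((\<Sum>g\<in>carrier G. \<phi> (H(- K := g \<otimes> H (- K))) (- K - 1)) +
      (\<Sum>g\<in>carrier G. \<phi> (H(- K + 1 := g \<otimes> H (- K + 1))) (- K + 1)))"
    by (simp add: sum_wreath_gens)
  moreover have "of_nat (card (wreath_gens G)) = complex_of_real (2 * n)"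
    by (simp flip: card_wreath_gens)
  ultimately show ?thesis using FK by (simp add: markov_operator_def)
qed

text \<open>\<open>pat A\<close> is uniform on the lamps in \<open>A\<close> and the point mass at the identity on all other lamps;
  \<open>closed_pat A a b\<close> has the mean-zero factor \<open>\<delta>\<^sub>1 - 1/n\<close> at the lamps \<open>a\<close> and \<open>b\<close> as well, so that
  randomising one of these two lamps kills it.\<close>

definition pat :: "int set \<Rightarrow> (int \<Rightarrow> 'a) \<Rightarrow> real"
  where "pat A F = (if \<forall>i. i \<notin> A \<longrightarrow> F i = \<one> then (1 / n) ^ card A else 0)"

definition closed_pat :: "int set \<Rightarrow> int \<Rightarrow> int \<Rightarrow> (int \<Rightarrow> 'a) \<Rightarrow> real"
  where "closed_pat A a b F =
    pat A F - pat (insert a A) F - pat (insert b A) F + pat (insert a (insert b A)) F"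

text \<open>A uniform lamp is unaffected. Otherwise only \<open>g = inv (F j)\<close> resets lamp
  \<open>j\<close> to the identity, and (1/n)^(card A) is n times the value with one more uniform
  lamp.\<close>

lemma sum_pat:
  assumes "finite A" "F j \<in> carrier G"
  shows "(\<Sum>g\<in>carrier G. pat A (F(j := g \<otimes> F j))) = n * pat (insert j A) F"
proof (cases "j \<in> A")
  case True
  then have "pat A (F(j := g \<otimes> F j)) = pat A F" for g
    unfolding pat_def by (intro if_cong) auto
  then show ?thesis using True by (simp add: order_def insert_absorb)
next
  case False
  have "pat A (F(j := g \<otimes> F j)) = (if g = inv (F j) then n * pat (insert j A) F else 0)"
    if g: "g \<in> carrier G" for g
  proof -
    have "g \<otimes> F j = \<one> \<longleftrightarrow> g = inv (F j)"
      using g assms(2) by (metis inv_equality inv_inv inv_closed l_inv)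
    then have "(\<forall>i. i \<notin> A \<longrightarrow> (F(j := g \<otimes> F j)) i = \<one>) \<longleftrightarrow>
        g = inv (F j) \<and> (\<forall>i. i \<notin> insert j A \<longrightarrow> F i = \<one>)"
      using False by auto
    then show ?thesis using False assms(1) n_pos by (auto simp: pat_def)
  qed
  then have "(\<Sum>g\<in>carrier G. pat A (F(j := g \<otimes> F j))) =
      (\<Sum>g\<in>carrier G. if g = inv (F j) then n * pat (insert j A) F else 0)"
    by (intro sum.cong) auto
  then show ?thesis using finite_G assms(2) by simp
qed

lemma sum_closed_pat:
  assumes "finite A" "F j \<in> carrier G"
  shows "(\<Sum>g\<in>carrier G. closed_pat A a b (F(j := g \<otimes> F j))) =
    n * (pat (insert j A) F - pat (insert j (insert a A)) F - pat (insert j (insert b A)) F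
      + pat (insert j (insert a (insert b A))) F)"
  using assms by (simp add: closed_pat_def sum.distrib sum_subtractf sum_pat algebra_simps)

lemma sum_closed_pat_inside:
  assumes "finite A" "F j \<in> carrier G" "j \<in> A"
  shows "(\<Sum>g\<in>carrier G. closed_pat A a b (F(j := g \<otimes> F j))) = n * closed_pat A a b F"
  unfolding sum_closed_pat[of A F j, OF assms(1,2)] using assms(3)
  by (simp add: insert_absorb closed_pat_def)

text \<open>Inserting \<open>a\<close>, or \<open>b\<close>, into all four lamp sets makes them
  coincide in pairs of opposite sign.\<close>

lemma sum_closed_pat_ends:
  assumes "finite A" "F j \<in> carrier G" "j = a \<or> j = b"
  shows "(\<Sum>g\<in>carrier G. closed_pat A a b (F(j := g \<otimes> F j))) = 0"
  unfolding sum_closed_pat[of A F j, OF assms(1,2)] using assms(3) by (auto simp: insert_commute)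

text \<open>The path has vertices -a, ..., b. With Q = a + b + 2, vertex m has number m + a + 1, and
  the sine vanishes at the missing neighbours numbered 0 and Q. Lamp i sits on the edge from i - 1
  to i, so the inner lamps form \<open>{- int a<..int b}\<close> and the bounding lamps are -a and b
  + 1.\<close>

definition eigfun :: "nat \<Rightarrow> nat \<Rightarrow> nat \<Rightarrow> (int \<Rightarrow> 'a) \<Rightarrow> int \<Rightarrow> real"
  where "eigfun a b k H m =
    (if - int a \<le> m \<and> m \<le> int b
     then sin (pi * real k * (real_of_int m + real a + 1) / real (a + b + 2)) *
       closed_pat {- int a<..int b} (- int a) (int b + 1) H
     else 0)"

lemma eigfun_step:
  assumes H: "\<And>i. H i \<in> carrier G"
  shows "(\<Sum>g\<in>carrier G. eigfun a b k (H(m := g \<otimes> H m)) (m - 1)) +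
      (\<Sum>g\<in>carrier G. eigfun a b k (H(m + 1 := g \<otimes> H (m + 1))) (m + 1)) =
    2 * n * cos (pi * real k / real (a + b + 2)) * eigfun a b k H m"
proof -
  define \<theta> where "\<theta> = pi * real k / real (a + b + 2)"
  define s where "s m = sin (\<theta> * (real_of_int m + real a + 1))" for m
  define P where "P = closed_pat {- int a<..int b} (- int a) (int b + 1)"
  have ef: "eigfun a b k H m = (if - int a \<le> m \<and> m \<le> int b then s m * P H else 0)" for H m
    by (simp add: eigfun_def s_def \<theta>_def P_def)
  have s0: "s (- int a - 1) = 0" by (simp add: s_def)
  have "\<theta> * (real b + 1 + real a + 1) = real k * pi" by (simp add: \<theta>_def field_simps)
  then have s1: "s (int b + 1) = 0" by (simp add: s_def)
  have s2: "s (m - 1) + s (m + 1) = 2 * cos \<theta> * s m"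
  proof -
    let ?y = "\<theta> * (real_of_int m + real a + 1)"
    have "s (m - 1) = sin (?y - \<theta>)" "s (m + 1) = sin (?y + \<theta>)"
      by (simp_all add: s_def algebra_simps)
    then show ?thesis by (simp add: s_def[of m] sin_add sin_diff)
  qed
  have inside: "(\<Sum>g\<in>carrier G. P (H(j := g \<otimes> H j))) = n * P H" if "- int a < j" "j \<le> int b" for j
    unfolding P_def by (rule sum_closed_pat_inside) (use H that in auto)
  have ends: "(\<Sum>g\<in>carrier G. P (H(j := g \<otimes> H j))) = 0" if "j = - int a \<or> j = int b + 1" for j
    unfolding P_def by (rule sum_closed_pat_ends) (use H that in auto)
  \<comment> \<open>Stepping out of the segment meets a zero of the sine, so the uniform formula
    holds at the end vertices as well; stepping in from outside randomises a bounding lamp and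
    averages to 0.\<close>
  have "(\<Sum>g\<in>carrier G. eigfun a b k (H(m := g \<otimes> H m)) (m - 1)) =
      (if - int a \<le> m \<and> m \<le> int b then s (m - 1) * (n * P H) else 0)"
    using inside[of m] ends[of m] s0
    by (cases "m = - int a"; cases "m = int b + 1") (auto simp: ef simp flip: sum_distrib_left)
  moreover have "(\<Sum>g\<in>carrier G. eigfun a b k (H(m + 1 := g \<otimes> H (m + 1))) (m + 1)) =
      (if - int a \<le> m \<and> m \<le> int b then s (m + 1) * (n * P H) else 0)"
    using inside[of "m + 1"] ends[of "m + 1"] s1
    by (cases "m + 1 = - int a"; cases "m = int b") (auto simp: ef simp flip: sum_distrib_left)
  moreover have "s (m - 1) * (n * P H) + s (m + 1) * (n * P H) = 2 * n * cos \<theta> * (s m * P H)"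
    using s2 by (simp flip: distrib_right)
  ultimately show ?thesis unfolding \<theta>_def[symmetric] by (simp add: ef)
qed

section \<open>The eigenfunctions as finitely supported vectors\<close>

definition configs :: "int set \<Rightarrow> (int \<Rightarrow> 'a) set"
  where "configs A = PiE_dflt A \<one> (\<lambda>_. carrier G)"

lemma configs_iff:
  assumes "finite A"
  shows "F \<in> configs A \<longleftrightarrow> (F, K) \<in> carrier W \<and> (\<forall>i. i \<notin> A \<longrightarrow> F i = \<one>)"
proof
  assume F: "F \<in> configs A"
  then have "{i. F i \<noteq> \<one>} \<subseteq> A" by (auto simp: configs_def PiE_dflt_def)
  then have "finite {i. F i \<noteq> \<one>}" using assms by (rule finite_subset)
  with F show "(F, K) \<in> carrier W \<and> (\<forall>i. i \<notin> A \<longrightarrow> F i = \<one>)"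
    by (auto simp: carrier_W configs_def PiE_dflt_def) (metis one_closed)
qed (auto simp: carrier_W configs_def PiE_dflt_def)

lemma finite_configs: "finite A \<Longrightarrow> finite (configs A)"
  using finite_G by (auto simp: configs_def)

lemma card_configs: "finite A \<Longrightarrow> card (configs A) = order G ^ card A"
  using finite_G by (simp add: configs_def card_PiE_dflt order_def)

text \<open>The guard makes the map total; the functions fed to it below are shown to have finite
  support.\<close>

lift_definition ell2_of_real_fun :: "('c \<Rightarrow> real) \<Rightarrow> 'c ell2"
  is "\<lambda>f x. if finite {x. f x \<noteq> 0} then complex_of_real (f x) else 0"
  by (rule finite_nonzero_values_imp_summable_on) (auto elim: rev_finite_subset)

definition eigvec :: "nat \<Rightarrow> nat \<Rightarrow> nat \<Rightarrow> ((int \<Rightarrow> 'a) \<times> int) ell2"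
  where "eigvec a b k = ell2_of_real_fun
    (\<lambda>(F, K). if (F, K) \<in> carrier W then eigfun a b k (\<lambda>i. F (i + K)) (- K) else 0)"

lemma finite_support_eigfun:
  "finite {x. (case x of (F, K) \<Rightarrow> if (F, K) \<in> carrier W then eigfun a b k (\<lambda>i. F (i + K)) (- K) else 0) \<noteq> 0}"
proof (rule finite_subset)
  let ?A = "{- int a..int b + 1}"
  show "finite (\<Union>K\<in>{- int b..int a}. (\<lambda>H. ((\<lambda>i. H (i - K)), K)) ` configs ?A)"
    by (auto intro: finite_configs)
  show "{x. (case x of (F, K) \<Rightarrow> if (F, K) \<in> carrier W then eigfun a b k (\<lambda>i. F (i + K)) (- K) else 0) \<noteq> 0} \<subseteq>
      (\<Union>K\<in>{- int b..int a}. (\<lambda>H. ((\<lambda>i. H (i - K)), K)) ` configs ?A)"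
  proof clarsimp
    fix F K
    assume "(if (F, K) \<in> carrier W then eigfun a b k (\<lambda>i. F (i + K)) (- K) else 0) \<noteq> 0"
    then have FK: "(F, K) \<in> carrier W" and K: "- int b \<le> K" "K \<le> int a"
      and nz: "closed_pat {- int a<..int b} (- int a) (int b + 1) (\<lambda>i. F (i + K)) \<noteq> 0"
      by (auto simp: eigfun_def split: if_splits)
    have sub: "B \<subseteq> ?A" if "B \<in> {{- int a<..int b}, insert (- int a) {- int a<..int b},
        insert (int b + 1) {- int a<..int b}, insert (- int a) (insert (int b + 1) {- int a<..int b})}" for B
      using that by auto
    have "\<exists>B \<subseteq> ?A. pat B (\<lambda>i. F (i + K)) \<noteq> 0"
      by (rule ccontr) (use nz sub in \<open>simp add: closed_pat_def\<close>)
    then have "\<forall>i. i \<notin> ?A \<longrightarrow> F (i + K) = \<one>"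
      by (auto simp: pat_def split: if_splits)
    then have "(\<lambda>i. F (i + K)) \<in> configs ?A"
      using FK by (auto simp: configs_def PiE_dflt_def carrier_W)
    moreover have "F = (\<lambda>i. (\<lambda>i. F (i + K)) (i - K))" by simp
    ultimately show "\<exists>x\<in>{- int b..int a}. (F, K) \<in> (\<lambda>H. (\<lambda>i. H (i - x), x)) ` configs ?A"
      using K by (intro bexI[of _ K] image_eqI[where x = "\<lambda>i. F (i + K)"]) auto
  qed
qed

lemma ell2_fun_eigvec:
  "ell2_fun (eigvec a b k) =
    (\<lambda>(F, K). if (F, K) \<in> carrier W then complex_of_real (eigfun a b k (\<lambda>i. F (i + K)) (- K)) else 0)"
  unfolding eigvec_def ell2_of_real_fun.rep_eq using finite_support_eigfun[of a b k]
  by (auto simp: fun_eq_iff)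

lemma eigvec_supported: "ell2_supported (carrier W) (eigvec a b k)"
  by (auto simp: ell2_supported_def ell2_fun_eigvec)

lemma T_eigvec: "RW.T (eigvec a b k) = cos (pi * real k / real (a + b + 2)) *\<^sub>R eigvec a b k"
proof (rule ell2_eqI)
  fix x :: "(int \<Rightarrow> 'a) \<times> int"
  obtain F K where x: "x = (F, K)" by (cases x)
  show "ell2_fun (RW.T (eigvec a b k)) x = ell2_fun (cos (pi * real k / real (a + b + 2)) *\<^sub>R eigvec a b k) x"
  proof (cases "(F, K) \<in> carrier W")
    case True
    then have "F (i + K) \<in> carrier G" for i by (simp add: carrier_W)
    from eigfun_step[of "\<lambda>i. F (i + K)" a b k "- K", OF this] n_pos
    show ?thesis
      unfolding x RW.ell2_fun_T ell2_fun_eigvec markov_operator_frame[OF True, of "eigfun a b k"]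
      using True by (simp add: scaleR_ell2.rep_eq ell2_fun_eigvec scaleR_conv_of_real)
  next
    case False
    then show ?thesis
      by (simp add: x RW.ell2_fun_T markov_operator_def scaleR_ell2.rep_eq ell2_fun_eigvec)
  qed
qed

section \<open>Telescoping expansion of the point mass at the identity\<close>

definition patvec :: "nat \<Rightarrow> nat \<Rightarrow> ((int \<Rightarrow> 'a) \<times> int) ell2"
  where "patvec a b = ell2_of_real_fun
    (\<lambda>(F, K). if (F, K) \<in> carrier W \<and> K = 0 then pat {- int a<..int b} F else 0)"

lemma ell2_fun_patvec:
  "ell2_fun (patvec a b) =
    (\<lambda>(F, K). if (F, K) \<in> carrier W \<and> K = 0 then complex_of_real (pat {- int a<..int b} F) else 0)"
proof -
  have "{x. (case x of (F, K) \<Rightarrow> if (F, K) \<in> carrier W \<and> K = 0 then pat {- int a<..int b} F else 0) \<noteq> 0} \<subseteq>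
      configs {- int a<..int b} \<times> {0}"
    by (auto simp: pat_def configs_iff[where K = 0] split: if_splits)
  then have "finite {x. (case x of (F, K) \<Rightarrow> if (F, K) \<in> carrier W \<and> K = 0 then pat {- int a<..int b} F else 0) \<noteq> 0}"
    by (rule finite_subset) (auto intro: finite_configs)
  then show ?thesis
    unfolding patvec_def ell2_of_real_fun.rep_eq by (auto simp: fun_eq_iff)
qed

text \<open>There are n^(a+b) configurations in the support, each with value n^(-(a+b)). Hence the
  telescoping remainders vanish in the limit although each has total mass 1.\<close>

lemma norm_patvec: "(norm (patvec a b))\<^sup>2 = (1 / n) ^ (a + b)"
proof -
  let ?A = "{- int a<..int b}"
  have "((\<lambda>x. (cmod (ell2_fun (patvec a b) x))\<^sup>2) has_sum
      (\<Sum>x\<in>configs ?A \<times> {0::int}. ((1 / n) ^ (a + b))\<^sup>2)) UNIV"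
  proof (rule has_sum_finite_neutralI)
    show "finite (configs ?A \<times> {0::int})" by (auto intro: finite_configs)
    show "(cmod (ell2_fun (patvec a b) x))\<^sup>2 = 0" if "x \<in> UNIV - configs ?A \<times> {0::int}" for x
      using that configs_iff[of ?A "fst x" 0] by (cases x) (auto simp: ell2_fun_patvec pat_def)
    have "(cmod (ell2_fun (patvec a b) x))\<^sup>2 = ((1 / n) ^ (a + b))\<^sup>2" if "x \<in> configs ?A \<times> {0::int}" for x
      using that configs_iff[of ?A "fst x" 0] n_pos
      by (cases x) (auto simp: ell2_fun_patvec pat_def nat_add_distrib add.commute norm_divide norm_power)
    then show "(\<Sum>x\<in>configs ?A \<times> {0::int}. ((1 / n) ^ (a + b))\<^sup>2) =
        (\<Sum>x\<in>configs ?A \<times> {0::int}. (cmod (ell2_fun (patvec a b) x))\<^sup>2)" by simp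
  qed simp
  then have "(norm (patvec a b))\<^sup>2 = (\<Sum>x\<in>configs ?A \<times> {0::int}. ((1 / n) ^ (a + b))\<^sup>2)"
    by (rule has_sum_unique[OF ell2_norm_has_sum])
  also have "\<dots> = n ^ (a + b) * ((1 / n) ^ (a + b))\<^sup>2"
    by (simp add: card_cartesian_product card_configs nat_add_distrib add.commute)
  also have "\<dots> = (1 / n) ^ (a + b)"
    using n_pos by (simp add: power2_eq_square power_one_over)
  finally show ?thesis .
qed

lemma patvec_0: "patvec 0 0 = ell2_delta \<one>\<^bsub>W\<^esub>"
  by (rule ell2_eqI) (auto simp: ell2_fun_patvec ell2_delta.rep_eq one_wreath_int pat_def carrier_W fun_eq_iff
      split: if_splits)

text \<open>On the path the point mass at vertex 0, which has number a + 1, has sine coefficients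
  (2/Q) sin (pi k (a+1) / Q). Since the four lamp sets of \<open>closed_pat\<close> are intervals
  with some ends extended by one, the result is a mixed second difference of
  \<open>patvec\<close>.\<close>

lemma sum_eigvec:
  "(\<Sum>k=1..<a+b+2. (2 / real (a + b + 2) * sin (pi * real k * real (a + 1) / real (a + b + 2))) *\<^sub>R eigvec a b k) =
    patvec a b - patvec (Suc a) b - patvec a (Suc b) + patvec (Suc a) (Suc b)"
proof (rule ell2_eqI)
  fix x :: "(int \<Rightarrow> 'a) \<times> int"
  obtain F K where x: "x = (F, K)" by (cases x)
  let ?Q = "a + b + 2"
  let ?P = "closed_pat {- int a<..int b} (- int a) (int b + 1)"
  let ?c = "\<lambda>k. 2 / real ?Q * sin (pi * real k * real (a + 1) / real ?Q)"
  have lhs: "ell2_fun (\<Sum>k\<in>I. c k *\<^sub>R eigvec a b k) x =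
      (if (F, K) \<in> carrier W then complex_of_real (\<Sum>k\<in>I. c k * eigfun a b k (\<lambda>i. F (i + K)) (- K)) else 0)" for I c
    by (simp add: x ell2_fun_sum scaleR_ell2.rep_eq ell2_fun_eigvec scaleR_conv_of_real)
  have "(\<Sum>k=1..<?Q. ?c k * eigfun a b k H (- K)) = (if K = 0 then ?P H else 0)" for H
  proof (cases "- int a \<le> - K \<and> - K \<le> int b")
    case True
    \<comment> \<open>The number of the vertex \<open>- K\<close> on the path, counted from 1 at the
      left end.\<close>
    define j where "j = nat (int a - K + 1)"
    have j: "1 \<le> j" "j < ?Q" "real j = real_of_int (- K) + real a + 1" "j = a + 1 \<longleftrightarrow> K = 0"
      using True by (auto simp: j_def)
    have "(\<Sum>k=1..<?Q. ?c k * eigfun a b k H (- K)) =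
        2 / real ?Q * ?P H * (\<Sum>k=1..<?Q. sin (pi * real k * real (a + 1) / real ?Q) * sin (pi * real k * real j / real ?Q))"
      unfolding sum_distrib_left
      by (rule sum.cong) (use True j(3) in \<open>simp_all add: eigfun_def\<close>)
    also have "\<dots> = (if K = 0 then ?P H else 0)"
      using j by (subst sum_sin_sin_roots) auto
    finally show ?thesis .
  next
    case False
    then show ?thesis by (auto simp: eigfun_def)
  qed
  moreover have "?P F = pat {- int a<..int b} F - pat {- int (Suc a)<..int b} F - pat {- int a<..int (Suc b)} F
      + pat {- int (Suc a)<..int (Suc b)} F"
  proof -
    have "insert (- int a) {- int a<..int b} = {- int (Suc a)<..int b}"
      "insert (int b + 1) {- int a<..int b} = {- int a<..int (Suc b)}"
      "insert (- int a) (insert (int b + 1) {- int a<..int b}) = {- int (Suc a)<..int (Suc b)}"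
      by auto
    then show ?thesis unfolding closed_pat_def by simp
  qed
  ultimately show "ell2_fun (\<Sum>k=1..<?Q. ?c k *\<^sub>R eigvec a b k) x =
      ell2_fun (patvec a b - patvec (Suc a) b - patvec a (Suc b) + patvec (Suc a) (Suc b)) x"
    unfolding lhs
    by (auto simp: x plus_ell2.rep_eq minus_ell2.rep_eq ell2_fun_patvec simp del: of_nat_Suc)
qed

lemma closed_pat_one:
  "closed_pat {- int a<..int b} (- int a) (int b + 1) (\<lambda>_. \<one>) = (1 / n) ^ (a + b) * (1 - 1 / n)\<^sup>2"
  by (simp add: closed_pat_def pat_def nat_add_distrib card_insert_if add.commute power2_eq_square algebra_simps)

lemma ell2_fun_eigvec_one:
  "ell2_fun (eigvec a b k) \<one>\<^bsub>W\<^esub> = complex_of_real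
    (sin (pi * real k * real (a + 1) / real (a + b + 2)) * ((1 / n) ^ (a + b) * (1 - 1 / n)\<^sup>2))"
  using W.one_closed
  by (simp add: one_wreath_int ell2_fun_eigvec eigfun_def closed_pat_one add.commute[of 1 "real a"])

lemma double_telescope:
  fixes u :: "nat \<Rightarrow> nat \<Rightarrow> 'c::ab_group_add"
  shows "(\<Sum>(a, b)\<in>{..N}\<times>{..N}. u a b - u (Suc a) b - u a (Suc b) + u (Suc a) (Suc b)) =
    u 0 0 - u (Suc N) 0 - u 0 (Suc N) + u (Suc N) (Suc N)"
proof -
  have "(\<Sum>(a, b)\<in>{..N}\<times>{..N}. u a b - u (Suc a) b - u a (Suc b) + u (Suc a) (Suc b)) =
      (\<Sum>a\<le>N. \<Sum>b\<le>N. (u a b - u (Suc a) b) - (u a (Suc b) - u (Suc a) (Suc b)))"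
    unfolding sum.cartesian_product by (intro sum.cong) auto
  also have "\<dots> = (\<Sum>a\<le>N. (u a 0 - u a (Suc N)) - (u (Suc a) 0 - u (Suc a) (Suc N)))"
    by (intro sum.cong refl) (rule trans[OF sum_telescope], simp add: algebra_simps)
  also have "\<dots> = u 0 0 - u (Suc N) 0 - u 0 (Suc N) + u (Suc N) (Suc N)"
    by (subst sum_telescope) simp
  finally show ?thesis .
qed

section \<open>Spectral weights of the segments\<close>

abbreviation index_set :: "nat \<Rightarrow> ((nat \<times> nat) \<times> nat) set"
  where "index_set N \<equiv> (SIGMA (a, b):{..N}\<times>{..N}. {1..<a+b+2})"

definition component :: "(nat \<times> nat) \<times> nat \<Rightarrow> ((int \<Rightarrow> 'a) \<times> int) ell2"
  where "component = (\<lambda>((a, b), k).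
    (2 / real (a + b + 2) * sin (pi * real k * real (a + 1) / real (a + b + 2))) *\<^sub>R eigvec a b k)"

lemma component_supported: "ell2_supported (carrier W) (component i)"
  by (auto simp: component_def eigvec_supported split: prod.split)

lemma T_component:
  "RW.T (component i) = (case i of ((a, b), k) \<Rightarrow> cos (pi * real k / real (a + b + 2))) *\<^sub>R component i"
  by (auto simp: component_def T_eigvec linear_simps[OF RW.bounded_linear_T] split: prod.split)

text \<open>The double telescope leaves \<open>patvec 0 0\<close>, the point mass, and three
  remainders. Their norms are powers of sqrt (1/n) with growing exponents, and 1/n < 1 because the
  group is non-trivial.\<close>

lemma component_limit:
  assumes "order G \<ge> 2"
  shows "(\<lambda>N. \<Sum>i\<in>index_set N. component i) \<longlonglongrightarrow> ell2_delta \<one>\<^bsub>W\<^esub>"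
proof -
  have eq: "(\<Sum>i\<in>index_set N. component i) =
      patvec 0 0 - patvec (Suc N) 0 - patvec 0 (Suc N) + patvec (Suc N) (Suc N)" for N
  proof -
    have "(\<Sum>i\<in>index_set N. component i) = (\<Sum>x\<in>{..N}\<times>{..N}. \<Sum>k\<in>(case x of (a, b) \<Rightarrow> {1..<a+b+2}). component (x, k))"
      by (subst sum.Sigma) (auto simp: case_prod_unfold)
    also have "\<dots> = (\<Sum>(a, b)\<in>{..N}\<times>{..N}.
        patvec a b - patvec (Suc a) b - patvec a (Suc b) + patvec (Suc a) (Suc b))"
      by (intro sum.cong) (auto simp: component_def sum_eigvec[symmetric] simp del: of_nat_add)
    finally show ?thesis by (simp only: double_telescope)
  qed
  have norm: "norm (patvec a b) = sqrt ((1 / n) ^ (a + b))" for a b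
    by (simp flip: norm_patvec)
  have "1 / n < 1" "0 \<le> 1 / n" using assms by auto
  then have lim: "(\<lambda>N. (1 / n) ^ N) \<longlonglongrightarrow> 0" by (intro LIMSEQ_power_zero) auto
  have tend: "(\<lambda>N. patvec (f N) (g N)) \<longlonglongrightarrow> 0" if "filterlim (\<lambda>N. f N + g N) at_top sequentially" for f g
  proof (rule tendsto_norm_zero_cancel)
    have "(\<lambda>N. sqrt ((1 / n) ^ (f N + g N))) \<longlonglongrightarrow> sqrt 0"
      by (intro tendsto_intros filterlim_compose[OF lim that])
    then show "(\<lambda>N. norm (patvec (f N) (g N))) \<longlonglongrightarrow> 0" by (simp add: norm)
  qed
  have "(\<lambda>N. patvec 0 0 - patvec (Suc N) 0 - patvec 0 (Suc N) + patvec (Suc N) (Suc N)) \<longlonglongrightarrow>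
      patvec 0 0 - 0 - 0 + 0"
    by (intro tendsto_add tendsto_diff tend tendsto_const filterlim_at_top_mono[OF filterlim_ident] always_eventually)
      auto
  then show ?thesis by (simp only: eq patvec_0 diff_0_right add_0_right)
qed

text \<open>The mass that one segment gives to \<open>B\<close>: sine coefficient times the value of
  the eigenvector at the identity, hence the square and the nonnegativity.\<close>

definition weight :: "real set \<Rightarrow> nat \<times> nat \<Rightarrow> real"
  where "weight B = (\<lambda>(a, b). \<Sum>k=1..<a+b+2. of_bool (cos (real k / real (a + b + 2) * pi) \<in> B) *
    (2 / real (a + b + 2) * (sin (pi * real k * real (a + 1) / real (a + b + 2)))\<^sup>2) *
    ((1 / n) ^ (a + b) * (1 - 1 / n)\<^sup>2))"

lemma weight_has_sum:
  assumes "order G \<ge> 2" "B \<in> sets borel" "B \<subseteq> {-1..1}"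
  shows "\<exists>c. emeasure (kesten_spectral_measure W (wreath_gens G)) B = ennreal c \<and> (weight B has_sum c) UNIV"
proof -
  obtain c where c: "emeasure (kesten_spectral_measure W (wreath_gens G)) B = ennreal c"
    and lim: "(\<lambda>N. \<Sum>i\<in>index_set N. if (case i of ((a, b), k) \<Rightarrow> cos (pi * real k / real (a + b + 2))) \<in> B
        then Re (ell2_fun (component i) \<one>\<^bsub>W\<^esub>) else 0) \<longlonglongrightarrow> c"
    using RW.emeasure_kesten_spectral_measure[OF component_limit[OF assms(1)] component_supported T_component assms(2,3)]
    by blast
  have "(\<Sum>i\<in>index_set N. if (case i of ((a, b), k) \<Rightarrow> cos (pi * real k / real (a + b + 2))) \<in> B
        then Re (ell2_fun (component i) \<one>\<^bsub>W\<^esub>) else 0) = (\<Sum>x\<in>{..N}\<times>{..N}. weight B x)" for N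
  proof -
    have "(\<Sum>i\<in>index_set N. if (case i of ((a, b), k) \<Rightarrow> cos (pi * real k / real (a + b + 2))) \<in> B
        then Re (ell2_fun (component i) \<one>\<^bsub>W\<^esub>) else 0) =
      (\<Sum>x\<in>{..N}\<times>{..N}. \<Sum>k\<in>(case x of (a, b) \<Rightarrow> {1..<a+b+2}).
        if (case (x, k) of ((a, b), k) \<Rightarrow> cos (pi * real k / real (a + b + 2))) \<in> B
        then Re (ell2_fun (component (x, k)) \<one>\<^bsub>W\<^esub>) else 0)"
      by (subst sum.Sigma) (auto simp: case_prod_unfold cong: if_cong)
    also have "\<dots> = (\<Sum>x\<in>{..N}\<times>{..N}. weight B x)"
    proof (rule sum.cong)
      fix x :: "nat \<times> nat"
      obtain a b where x: "x = (a, b)" by (cases x)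
      show "(\<Sum>k\<in>(case x of (a, b) \<Rightarrow> {1..<a+b+2}).
        if (case (x, k) of ((a, b), k) \<Rightarrow> cos (pi * real k / real (a + b + 2))) \<in> B
        then Re (ell2_fun (component (x, k)) \<one>\<^bsub>W\<^esub>) else 0) = weight B x"
        unfolding x weight_def prod.case
        by (rule sum.cong) (simp_all add: component_def scaleR_ell2.rep_eq ell2_fun_eigvec_one
            power2_eq_square mult_ac del: of_nat_add of_nat_Suc)
    qed simp
    finally show ?thesis .
  qed
  with lim have "(\<lambda>N. \<Sum>x\<in>{..N}\<times>{..N}. weight B x) \<longlonglongrightarrow> c" by simp
  moreover have "weight B x \<ge> 0" for x
  proof -
    obtain a b where x: "x = (a, b)" by (cases x)
    show ?thesis unfolding x weight_def prod.case by (rule sum_nonneg) simp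
  qed
  ultimately have "(weight B has_sum c) UNIV" by (intro has_sum_of_square_sums)
  with c show ?thesis by blast
qed

text \<open>The segments with a + b + 2 = q are the q - 1 placements of vertex 0 on a path. Over
  these placements the squared sines add up to q / 2, which cancels the factor 2 / q and leaves a
  mass independent of k.\<close>

lemma antidiagonal_weight:
  assumes q: "q \<ge> 2"
  shows "(\<Sum>a<q-1. weight B (a, q - 2 - a)) =
    (n - 1)\<^sup>2 * ((1 / n) ^ q * (\<Sum>k=1..<q. of_bool (cos (real k / real q * pi) \<in> B)))"
proof -
  let ?C = "(1 / n) ^ (q - 2) * (1 - 1 / n)\<^sup>2"
  let ?b = "\<lambda>k. of_bool (cos (real k / real q * pi) \<in> B) :: real"
  have "(\<Sum>a<q-1. weight B (a, q - 2 - a)) =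
      (\<Sum>a<q-1. \<Sum>k=1..<q. ?b k * (2 / real q * (sin (pi * real k * real (a + 1) / real q))\<^sup>2) * ?C)"
  proof (rule sum.cong)
    fix a assume "a \<in> {..<q-1}"
    then have "a + (q - 2 - a) = q - 2" "a + (q - 2 - a) + 2 = q" using q by auto
    then show "weight B (a, q - 2 - a) =
        (\<Sum>k=1..<q. ?b k * (2 / real q * (sin (pi * real k * real (a + 1) / real q))\<^sup>2) * ?C)"
      unfolding weight_def prod.case by (simp only:)
  qed simp
  also have "\<dots> = (\<Sum>k=1..<q. ?b k * (2 / real q * (\<Sum>a<q-1. (sin (pi * real k * real (a + 1) / real q))\<^sup>2)) * ?C)"
    by (subst sum.swap) (simp only: sum_distrib_left sum_distrib_right)
  also have "\<dots> = (\<Sum>k=1..<q. ?b k * ?C)"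
  proof (rule sum.cong)
    fix k assume k: "k \<in> {1..<q}"
    have "(\<Sum>a<q-1. (sin (pi * real k * real (a + 1) / real q))\<^sup>2) =
        (\<Sum>j=1..<q. sin (pi * real j * real k / real q) * sin (pi * real j * real k / real q))"
      by (rule sum.reindex_bij_witness[where i = "\<lambda>j. j - 1" and j = "\<lambda>a. a + 1"])
        (auto simp: power2_eq_square mult_ac)
    also have "\<dots> = real q / 2"
      using sum_sin_sin_roots[of k q k] k by simp
    finally have S: "(\<Sum>a<q-1. (sin (pi * real k * real (a + 1) / real q))\<^sup>2) = real q / 2" .
    show "?b k * (2 / real q * (\<Sum>a<q-1. (sin (pi * real k * real (a + 1) / real q))\<^sup>2)) * ?C = ?b k * ?C"
      unfolding S using q by simp
  qed simp
  also have "?C = (n - 1)\<^sup>2 * (1 / n) ^ q"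
  proof -
    obtain r where "q = r + 2" using q by (metis le_Suc_ex add.commute)
    then show ?thesis using n_pos by (simp add: power_add power2_eq_square field_simps)
  qed
  finally show ?thesis by (simp only: sum_distrib_right[symmetric]) (simp only: mult_ac)
qed

end

text \<open>Equality of measures is expressed on every Borel subset of [-1,1], with nonnegative
  extended sums; \<open>return borel\<close> is the Dirac measure.\<close>

theorem theorem5p12:
  fixes G :: "('a, 'b) monoid_scheme" and n :: nat and B :: "real set"
  assumes "group G" and "finite (carrier G)" and "carrier G \<noteq> {\<one>\<^bsub>G\<^esub>}" and "order G = n"
    and "B \<in> sets borel" and "B \<subseteq> {-1..1}"
  shows "emeasure (kesten_spectral_measure (wreath_int G) (wreath_gens G)) B =
    ennreal ((real n - 1)\<^sup>2) *
      (\<Sum>\<^sub>\<infinity>q\<in>{2..}. \<Sum>p | 1 \<le> p \<and> p < q \<and> coprime p q.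
        ennreal (1 / (real n ^ q - 1)) *
          emeasure (return borel (cos (real p / real q * pi))) B)"
proof -
  interpret group G by fact
  interpret lamplighter G by unfold_locales fact
  have n2: "order G \<ge> 2"
  proof (rule ccontr)
    assume "\<not> order G \<ge> 2"
    moreover have "order G > 0" using assms(2) by (simp add: order_gt_0_iff_finite)
    ultimately have "card (carrier G) = 1" by (simp add: order_def)
    then show False using assms(3) one_closed by (metis card_1_singletonE singletonD)
  qed
  obtain c where c: "emeasure (kesten_spectral_measure (wreath_int G) (wreath_gens G)) B = ennreal c"
    and w: "(weight B has_sum c) UNIV"
    using weight_has_sum[OF n2 assms(5,6)] by blast
  define x where "x = 1 / real n"
  have x: "0 < x" "x < 1" using n2 by (auto simp: x_def assms(4))
  have np: "(real n - 1)\<^sup>2 > 0" using n2 by (simp add: assms(4))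
  let ?s = "\<lambda>q. x ^ q * (\<Sum>k=1..<q. of_bool (cos (real k / real q * pi) \<in> B))"
  let ?t = "\<lambda>q. \<Sum>p | 1 \<le> p \<and> p < q \<and> coprime p q. x ^ q / (1 - x ^ q) * of_bool (cos (real p / real q * pi) \<in> B)"
  have "((\<lambda>q. (real n - 1)\<^sup>2 * ?s q) has_sum c) {2..}"
  proof (rule has_sum_cong[THEN iffD1, OF _ has_sum_antidiagonals[OF w]])
    fix q :: nat assume "q \<in> {2..}"
    then show "(\<Sum>a<q-1. weight B (a, q - 2 - a)) = (real n - 1)\<^sup>2 * ?s q"
      using antidiagonal_weight[of q B] by (simp only: x_def assms(4) atLeast_iff)
  qed
  \<comment> \<open>The factor (n-1)^2 is divided out because the passage to reduced fractions is
    stated for the bare weights \<open>x ^ q\<close>.\<close>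
  from has_sum_cmult_right[OF this, of "1 / (real n - 1)\<^sup>2"] np
  have "(?s has_sum c / (real n - 1)\<^sup>2) {2..}" by simp
  from has_sum_reduced_fractions[OF x, of "\<lambda>r. cos (r * pi) \<in> B", OF this]
  have t: "(?t has_sum c / (real n - 1)\<^sup>2) {2..}" .
  have xq: "x ^ q / (1 - x ^ q) = 1 / (real n ^ q - 1)" "1 \<le> real n ^ q" if "q \<ge> 2" for q
  proof -
    have "real n ^ q > 1" using n2 that by (intro one_less_power) (auto simp: assms(4))
    moreover have "n > 0" using n2 assms(4) by simp
    ultimately show "x ^ q / (1 - x ^ q) = 1 / (real n ^ q - 1)" "1 \<le> real n ^ q"
      by (auto simp: x_def power_one_over field_simps)
  qed
  have nonneg: "?t q \<ge> 0" if "q \<in> {2..}" for q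
    using that by (intro sum_nonneg) (simp add: xq)
  have "(\<Sum>\<^sub>\<infinity>q\<in>{2..}. \<Sum>p | 1 \<le> p \<and> p < q \<and> coprime p q.
        ennreal (1 / (real n ^ q - 1)) * emeasure (return borel (cos (real p / real q * pi))) B) =
      (\<Sum>\<^sub>\<infinity>q\<in>{2..}. ennreal (?t q))"
  proof (rule infsum_cong)
    fix q :: nat assume q: "q \<in> {2..}"
    have "ennreal (1 / (real n ^ q - 1)) * emeasure (return borel (cos (real p / real q * pi))) B =
        ennreal (x ^ q / (1 - x ^ q) * of_bool (cos (real p / real q * pi) \<in> B))" for p
      using assms(5) q by (simp add: xq indicator_def)
    moreover have "(\<Sum>p | 1 \<le> p \<and> p < q \<and> coprime p q.
        ennreal (x ^ q / (1 - x ^ q) * of_bool (cos (real p / real q * pi) \<in> B))) = ennreal (?t q)"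
      using q by (intro sum_ennreal) (simp add: xq)
    ultimately show "(\<Sum>p | 1 \<le> p \<and> p < q \<and> coprime p q.
        ennreal (1 / (real n ^ q - 1)) * emeasure (return borel (cos (real p / real q * pi))) B) = ennreal (?t q)"
      by simp
  qed
  also have "\<dots> = ennreal (c / (real n - 1)\<^sup>2)"
    using t nonneg by (rule infsum_ennreal)
  finally show ?thesis
    using np has_sum_nonneg[OF t nonneg] by (simp add: c ennreal_mult[symmetric])
qed

end
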